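(* Let $N\ge 3$, let $\ell$ be a positive integer, $1<p<\frac{N}{N-2}$, $y_i\in\mathbb{R}^N$, $\mu_i>0$ for $i=1,\ldots,\ell$, and $\lambda_{ij}=\lambda_{ji}<0$ for $i\ne j$. Let $\varepsilon_n>0$, $\varepsilon_n\to0$, and let $\mathbf v_n=(v_{n,1},\ldots,v_{n,\ell})$ be a solution of the system $$\begin{cases}-\Delta v_i+v_i=\mu_iQ_\varepsilon(x-y_i)|v_i|^{2p-2}v_i+\sum_{j\ne i}\lambda_{ij}|v_j|^p|v_i|^{p-2}v_i,\\ v_i\in H^1(\mathbb{R}^N),\quad v_i\neq 0,\quad i=1,\ldots,\ell,\end{cases}$$ with $\varepsilon=\varepsilon_n$. Then, for each $\delta>0$ and every $i=1,\ldots,\ell$, $$\lim_{n\to\infty}\frac{\int_{|x-y_i|\le\delta}(|\nabla v_{n,i}|^2+v_{n,i}^2)}{\int_{\mathbb{R}^N}(|\nabla v_{n,i}|^2+v_{n,i}^2)}=1\qquad\text{and}\qquad\lim_{n\to\infty}\frac{\int_{|x-y_i|\le\delta}|v_{n,i}|^{2p}}{\int_{\mathbb{R}^N}|v_{n,i}|^{2p}}=1.$$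
   Context: For $\varepsilon>0$, $Q_\varepsilon(x):=1$ if $|x|<\varepsilon$ and $Q_\varepsilon(x):=-1$ if $|x|\ge\varepsilon$. For $1<p<2$ the expression $|t|^{p-2}t$ is taken to be $0$ at $t=0$. Solutions are weak solutions in $(H^1(\mathbb{R}^N))^\ell$ with all components nontrivial. *)

theory Defs
  imports "HOL-Analysis.Analysis"
begin

text \<open>Functions on \<open>\<real>\<^sup>N\<close> are functions on a Euclidean space \<open>'a\<close> with \<open>N = DIM('a)\<close>. An element
  of a Lebesgue or Sobolev space is given by a Lebesgue measurable representative.\<close>

primrec Ck :: "nat \<Rightarrow> ('a::euclidean_space \<Rightarrow> real) \<Rightarrow> bool" where
  "Ck 0 f \<longleftrightarrow> continuous_on UNIV f"
| "Ck (Suc k) f \<longleftrightarrow> (\<forall>x. f differentiable at x) \<and>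
     (\<forall>b\<in>Basis. Ck k (\<lambda>x. frechet_derivative f (at x) b))"

definition test_function :: "('a::euclidean_space \<Rightarrow> real) \<Rightarrow> bool" where
  "test_function \<phi> \<longleftrightarrow> (\<forall>k. Ck k \<phi>) \<and> compact (closure {x. \<phi> x \<noteq> 0})"

definition locally_integrable :: "('a::euclidean_space \<Rightarrow> 'b::euclidean_space) \<Rightarrow> bool" where
  "locally_integrable f \<longleftrightarrow> (\<forall>K. compact K \<longrightarrow> set_integrable lebesgue K f)"

definition has_weak_gradient :: "('a::euclidean_space \<Rightarrow> real) \<Rightarrow> ('a \<Rightarrow> 'a) \<Rightarrow> bool" where
  "has_weak_gradient u G \<longleftrightarrow> locally_integrable u \<and> locally_integrable G \<and>
     (\<forall>\<phi>. test_function \<phi> \<longrightarrow> (\<forall>b\<in>Basis.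
        (LINT x|lebesgue. u x * frechet_derivative \<phi> (at x) b)
          = - (LINT x|lebesgue. (G x \<bullet> b) * \<phi> x)))"

text \<open>Weak gradients are unique up to a null set, so the choice below does not affect integrals.\<close>

definition weak_gradient :: "('a::euclidean_space \<Rightarrow> real) \<Rightarrow> 'a \<Rightarrow> 'a" where
  "weak_gradient u = (SOME G. has_weak_gradient u G)"

definition L2 :: "('a::euclidean_space \<Rightarrow> 'b::euclidean_space) set" where
  "L2 = {f. f \<in> borel_measurable lebesgue \<and> integrable lebesgue (\<lambda>x. (norm (f x))\<^sup>2)}"

definition H1 :: "('a::euclidean_space \<Rightarrow> real) set" where
  "H1 = {u. u \<in> L2 \<and> (\<exists>G. has_weak_gradient u G \<and> G \<in> L2)}"

definition Q :: "real \<Rightarrow> 'a::euclidean_space \<Rightarrow> real" where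
  "Q \<epsilon> x = (if norm x < \<epsilon> then 1 else -1)"

text \<open>The right-hand side of the \<open>i\<close>-th equation at the point \<open>x\<close>. At zeros of \<open>v i\<close> the factor
  \<open>\<bar>v i x\<bar> powr (p - 2) * v i x\<close> is \<open>0\<close>, as required for \<open>p < 2\<close>.\<close>

definition nonlinearity ::
  "nat \<Rightarrow> real \<Rightarrow> (nat \<Rightarrow> 'a::euclidean_space) \<Rightarrow> (nat \<Rightarrow> real) \<Rightarrow> (nat \<Rightarrow> nat \<Rightarrow> real) \<Rightarrow> real \<Rightarrow>
    (nat \<Rightarrow> 'a \<Rightarrow> real) \<Rightarrow> nat \<Rightarrow> 'a \<Rightarrow> real" where
  "nonlinearity l p y \<mu> \<Lambda> \<epsilon> v i x =
     \<mu> i * Q \<epsilon> (x - y i) * \<bar>v i x\<bar> powr (2 * p - 2) * v i x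
     + (\<Sum>j\<in>{1..l} - {i}. \<Lambda> i j * \<bar>v j x\<bar> powr p * (\<bar>v i x\<bar> powr (p - 2) * v i x))"

text \<open>Weak solutions are tested against all of \<open>H\<^sup>1\<close>. For \<open>1 < p < N/(N-2)\<close> all integrands below
  are integrable by the Sobolev embedding.\<close>

definition weak_solution ::
  "nat \<Rightarrow> real \<Rightarrow> (nat \<Rightarrow> 'a::euclidean_space) \<Rightarrow> (nat \<Rightarrow> real) \<Rightarrow> (nat \<Rightarrow> nat \<Rightarrow> real) \<Rightarrow> real \<Rightarrow>
    (nat \<Rightarrow> 'a \<Rightarrow> real) \<Rightarrow> bool" where
  "weak_solution l p y \<mu> \<Lambda> \<epsilon> v \<longleftrightarrow>
     (\<forall>i\<in>{1..l}. v i \<in> H1 \<and> \<not> (AE x in lebesgue. v i x = 0) \<and>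
       (\<forall>\<phi>\<in>H1.
          (LINT x|lebesgue. weak_gradient (v i) x \<bullet> weak_gradient \<phi> x + v i x * \<phi> x)
            = (LINT x|lebesgue. nonlinearity l p y \<mu> \<Lambda> \<epsilon> v i x * \<phi> x)))"

definition energy_density :: "('a::euclidean_space \<Rightarrow> real) \<Rightarrow> 'a \<Rightarrow> real" where
  "energy_density u x = (norm (weak_gradient u x))\<^sup>2 + (u x)\<^sup>2"

end

(*
  Test the i-th equation with w = v_i. Since all couplings are negative and the self-interaction is
  attractive only on |x - y_i| < eps, the squared H^1 norm E of w is at most mu_i times the integral of
  |w|^(2p) over that ball. By a subcritical Sobolev bound this integral is o(1) E^p as eps -> 0, so
  E tends to infinity.

  Testing with zeta w, where the cutoff zeta vanishes near y_i and is 1 away from y_i, gives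
    int zeta (|grad w|^2 + w^2 + mu_i |w|^(2p)) <= C int_A |w| |grad w|
  with an annulus A. In particular the integral of |w|^(2p) away from y_i is O(E). On the bounded set A
  the L^2 norm is controlled by the L^(2p) norm, so int_A w^2 = O(E^(1/p)) = o(E), and the right-hand
  side above is o(E). No compactness is needed.

  The Sobolev bound is obtained from the difference quotient estimate
  ||u(. + h) - u||_2 <= |h| ||grad u||_2 by bootstrapping bounds on the measure of {|u| > s}: a bound
  C s^(-q) improves to C' s^(-(2 + 2q/N)), and the iteration q -> 2 + 2q/N converges to 2N/(N - 2).
*)

theory Submission imports Defs begin

section \<open>Smooth functions\<close>

text \<open>The iteration on q is stopped at some q strictly above 2p, and this gap does double
  duty. The tail of |u|^(2p) over {|u| > M} is small for large M, uniformly on the unit ball of H^1,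
  while below the height M a small ball contributes at most M^(2p) times its volume. This makes the
  o(1) uniform in the function and in the centre; it becomes o(1) E^p by homogeneity. Divergence of
  E is recorded as E^(1-p) -> 0, the very factor that appears in the exterior error. The O(E) bound
  for |w|^(2p) must be available on the annulus A that carries the gradient of zeta, which zeta
  itself does not give. Hence a second cutoff, equal to 1 on A and supported closer to y_i. Hoelder
  on A is replaced by the pointwise split t^2 <= tau + tau^(1-p) |t|^(2p) with tau = kappa^2 E.
  Together with a kappa-weighted Young inequality the error is E (K kappa + D E^(1-p)): kappa is
  fixed first, n is sent to infinity afterwards. Elements of H^1 are Lebesgue measurable with a
  gradient chosen by \<open>SOME\<close>, but translations and Fubini ask for Borel functions; so
  the embedding is proved for Borel representatives and transferred almost everywhere.\<close>

lemma Ck_SucI: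
  assumes "\<And>x. (f has_derivative f' x) (at x)" and "\<And>b. b \<in> Basis \<Longrightarrow> Ck k (\<lambda>x. f' x b)"
  shows "Ck (Suc k) f"
proof -
  have "frechet_derivative f (at x) = f' x" for x
    using assms(1)[of x] by (simp add: frechet_derivative_at[symmetric])
  then show ?thesis
    using assms by (auto intro: differentiableI)
qed

lemma Ck_Suc_imp: "Ck (Suc k) f \<Longrightarrow> Ck k f"
proof (induction k arbitrary: f)
  case 0
  then show ?case
    by (auto simp: continuous_on_eq_continuous_at intro: differentiable_imp_continuous_within)
qed auto

lemma Ck_const: "Ck k (\<lambda>x. c)"
  by (induction k arbitrary: c) auto

lemma Ck_add: "Ck k f \<Longrightarrow> Ck k g \<Longrightarrow> Ck k (\<lambda>x. f x + g x)"
proof (induction k arbitrary: f g)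
  case 0
  then show ?case by (auto intro: continuous_on_add)
next
  case (Suc k)
  show ?case
  proof (rule Ck_SucI)
    show "((\<lambda>x. f x + g x) has_derivative
        (\<lambda>h. frechet_derivative f (at x) h + frechet_derivative g (at x) h)) (at x)" for x
      using Suc.prems by (intro has_derivative_add) (auto simp: frechet_derivative_works)
  qed (use Suc in auto)
qed

lemma Ck_mult: "Ck k f \<Longrightarrow> Ck k g \<Longrightarrow> Ck k (\<lambda>x. f x * g x)"
proof (induction k arbitrary: f g)
  case 0
  then show ?case by (auto intro: continuous_on_mult)
next
  case (Suc k)
  show ?case
  proof (rule Ck_SucI)
    show "((\<lambda>x. f x * g x) has_derivative
        (\<lambda>h. f x * frechet_derivative g (at x) h + frechet_derivative f (at x) h * g x)) (at x)" for x
      using Suc.prems by (intro has_derivative_mult) (auto simp: frechet_derivative_works)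
    show "Ck k (\<lambda>x. f x * frechet_derivative g (at x) b + frechet_derivative f (at x) b * g x)"
      if "b \<in> Basis" for b
      using that Suc.prems by (intro Ck_add Suc.IH) (auto intro: Ck_Suc_imp)
  qed
qed

lemma Ck_uminus: "Ck k f \<Longrightarrow> Ck k (\<lambda>x. - f x)"
  using Ck_mult[OF Ck_const[of k "-1"], of f] by simp

lemma Ck_diff: "Ck k f \<Longrightarrow> Ck k g \<Longrightarrow> Ck k (\<lambda>x. f x - g x)"
  using Ck_add[OF _ Ck_uminus, of k f g] by simp

lemma Ck_prod:
  assumes "finite A" "\<And>a. a \<in> A \<Longrightarrow> Ck k (f a)"
  shows "Ck k (\<lambda>x. \<Prod>a\<in>A. f a x)"
  using assms by (induction) (auto intro: Ck_const Ck_mult)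

lemma Ck_sum:
  assumes "finite A" "\<And>a. a \<in> A \<Longrightarrow> Ck k (f a)"
  shows "Ck k (\<lambda>x. \<Sum>a\<in>A. f a x)"
  using assms by (induction) (auto intro: Ck_const Ck_add)

lemma Ck_inner: "Ck k (\<lambda>x. x \<bullet> c)"
proof (cases k)
  case 0
  then show ?thesis by (auto intro!: continuous_intros)
next
  case (Suc m)
  have "Ck (Suc m) (\<lambda>x. x \<bullet> c)"
    by (rule Ck_SucI[where f' = "\<lambda>x h. h \<bullet> c"]) (auto intro!: derivative_eq_intros Ck_const)
  then show ?thesis using Suc by blast
qed

lemma Ck_norm_power2: "Ck k (\<lambda>x. (norm (x - c))\<^sup>2)"
proof -
  have "(norm (x - c))\<^sup>2 = (\<Sum>b\<in>Basis. (x \<bullet> b - c \<bullet> b) * (x \<bullet> b - c \<bullet> b))" for x :: 'a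
    unfolding power2_norm_eq_inner by (subst euclidean_inner) (simp add: inner_diff_left)
  then show ?thesis
    by (simp only:) (intro Ck_sum Ck_mult Ck_diff Ck_inner Ck_const finite_Basis)
qed

text \<open>All negative powers are included because derivatives of \<open>exp (- 1 / t)\<close> stay in the span of the family.\<close>

definition exp_inv :: "nat \<Rightarrow> real \<Rightarrow> real" where
  "exp_inv m t = (if t \<le> 0 then 0 else exp (- 1 / t) / t ^ m)"

lemma exp_inv_tendsto_0: "(exp_inv m \<longlongrightarrow> 0) (at 0)"
proof -
  have "((\<lambda>x. x ^ m / exp x) \<longlongrightarrow> (0::real)) at_top"
    by (rule tendsto_power_div_exp_0)
  then have "((\<lambda>t. inverse t ^ m / exp (inverse t)) \<longlongrightarrow> 0) (at_right (0::real))"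
    by (rule filterlim_compose) (rule filterlim_inverse_at_top_right)
  moreover have "\<forall>\<^sub>F t in at_right 0. exp_inv m t = inverse t ^ m / exp (inverse t)"
    by (auto simp: eventually_at_right_field exp_inv_def field_simps exp_minus intro!: exI[of _ 1])
  ultimately have "(exp_inv m \<longlongrightarrow> 0) (at_right 0)"
    by (simp cong: filterlim_cong)
  moreover have "(exp_inv m \<longlongrightarrow> 0) (at_left 0)"
    by (rule tendsto_eventually)
      (auto simp: eventually_at_left_field exp_inv_def intro!: exI[of _ "-1"])
  ultimately show ?thesis
    by (simp add: filterlim_split_at_real)
qed

lemma exp_inv_has_real_derivative:
  "(exp_inv m has_real_derivative exp_inv (m + 2) t - real m * exp_inv (m + 1) t) (at t)"
proof -
  consider "t < 0" | "t = 0" | "t > 0" by linarith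
  then show ?thesis
  proof cases
    case 1
    have "((\<lambda>t. 0) has_real_derivative 0) (at t)" by simp
    then have "(exp_inv m has_real_derivative 0) (at t)"
      by (rule has_field_derivative_transform_within_open[where S = "{..<0}"])
        (use 1 in \<open>auto simp: exp_inv_def\<close>)
    then show ?thesis using 1 by (simp add: exp_inv_def)
  next
    case 2
    \<comment> \<open>Dividing by h just raises the power in the denominator, so the derivative at 0
      is the limit \<open>exp_inv_tendsto_0\<close> for the next index. At h = 0 the equation holds
      because division by zero gives 0.\<close>
    have "(\<lambda>h. (exp_inv m (0 + h) - exp_inv m 0) / h) = exp_inv (Suc m)"
      by (auto simp: exp_inv_def fun_eq_iff field_simps)
    then have "(exp_inv m has_real_derivative 0) (at 0)"
      unfolding DERIV_def using exp_inv_tendsto_0[of "Suc m"] by simp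
    then show ?thesis using 2 by (simp add: exp_inv_def)
  next
    case 3
    have *: "1 / x ^ 2 * exp (- 1 / x) / x ^ m - exp (- 1 / x) * (real m * x ^ (m - 1)) / (x ^ m * x ^ m)
        = exp_inv (m + 2) x - real m * exp_inv (m + 1) x" if "x > 0" for x
      using that
      by (cases m) (auto simp: exp_inv_def field_simps power2_eq_square)
    have "((\<lambda>t. exp (- 1 / t) / t ^ m) has_real_derivative
       1 / t ^ 2 * exp (- 1 / t) / t ^ m - exp (- 1 / t) * (real m * t ^ (m - 1)) / (t ^ m * t ^ m)) (at t)"
      using 3 by (auto intro!: derivative_eq_intros simp: field_simps power2_eq_square)
    then have "(exp_inv m has_real_derivative exp_inv (m + 2) t - real m * exp_inv (m + 1) t) (at t)"
      unfolding *[OF 3]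
      by (rule has_field_derivative_transform_within_open[where S = "{0<..}"])
        (use 3 in \<open>auto simp: exp_inv_def\<close>)
    then show ?thesis .
  qed
qed

lemma Ck_exp_inv: "Ck k f \<Longrightarrow> Ck k (\<lambda>x. exp_inv m (f x))"
proof (induction k arbitrary: f m)
  case 0
  have "continuous_on UNIV (exp_inv m)"
    using exp_inv_has_real_derivative
    by (auto simp: continuous_on_eq_continuous_at intro: DERIV_isCont)
  then show ?case
    using 0 continuous_on_compose2[of UNIV "exp_inv m" UNIV f] by auto
next
  case (Suc k)
  show ?case
  proof (rule Ck_SucI)
    show "((\<lambda>x. exp_inv m (f x)) has_derivative
      (\<lambda>h. (exp_inv (m + 2) (f x) - real m * exp_inv (m + 1) (f x)) * frechet_derivative f (at x) h)) (at x)" for x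
    proof -
      have "(f has_derivative frechet_derivative f (at x)) (at x)"
        using Suc.prems by (auto simp: frechet_derivative_works)
      then show ?thesis
        using exp_inv_has_real_derivative[of m "f x"]
        unfolding has_field_derivative_def
        by (rule has_derivative_compose)
    qed
    show "Ck k (\<lambda>x. (exp_inv (m + 2) (f x) - real m * exp_inv (m + 1) (f x)) * frechet_derivative f (at x) b)"
      if "b \<in> Basis" for b
      using Ck_Suc_imp[OF Suc.prems] Suc.prems that
      by (intro Ck_mult Ck_diff Suc.IH Ck_const) auto
  qed
qed

lemma exp_inv_bounds: "0 \<le> exp_inv 0 t" "exp_inv 0 t \<le> 1"
  by (auto simp: exp_inv_def)

lemma exp_inv_pos_iff: "0 < exp_inv 0 t \<longleftrightarrow> 0 < t"
  by (auto simp: exp_inv_def)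

lemma exp_inv_mono: "s \<le> t \<Longrightarrow> exp_inv 0 s \<le> exp_inv 0 t"
  by (auto simp: exp_inv_def frac_le)

lemma exp_inv_scaled_tendsto: "(\<lambda>n. exp_inv 0 (real n * t)) \<longlonglongrightarrow> indicator {0<..} t"
proof (cases "t > 0")
  case True
  have "(\<lambda>n. exp (- inverse t * (1 / real n))) \<longlonglongrightarrow> exp (- inverse t * 0)"
    by (intro tendsto_intros lim_1_over_n)
  moreover have "\<forall>\<^sub>F n in sequentially. exp (- inverse t * (1 / real n)) = exp_inv 0 (real n * t)"
    using eventually_gt_at_top[of 0] proof eventually_elim
    case (elim n)
    then have "0 < real n * t" using True by simp
    then show ?case by (simp add: exp_inv_def not_le divide_simps)
  qed
  ultimately have "(\<lambda>n. exp_inv 0 (real n * t)) \<longlonglongrightarrow> exp (- inverse t * 0)"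
    by (rule Lim_transform_eventually)
  then show ?thesis using True by simp
qed (auto simp: exp_inv_def mult_le_0_iff)

text \<open>A smooth approximation of the indicator of an open box: each coordinate contributes one
  factor per face, and the scaling by n makes every factor tend to 1 inside the box. Boxes are
  enough because they generate the Borel sets.\<close>

definition bump :: "nat \<Rightarrow> 'a \<Rightarrow> 'a \<Rightarrow> 'a::euclidean_space \<Rightarrow> real" where
  "bump n a c x = (\<Prod>b\<in>Basis. exp_inv 0 (real n * (x \<bullet> b - a \<bullet> b)) * exp_inv 0 (real n * (c \<bullet> b - x \<bullet> b)))"

lemma bump_bounds: "0 \<le> bump n a c x" "bump n a c x \<le> 1"
  unfolding bump_def
  by (auto intro!: prod_nonneg prod_le_1 mult_le_one simp: exp_inv_bounds)

lemma bump_eq_0: "x \<notin> box a c \<Longrightarrow> bump n a c x = 0"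
  unfolding bump_def
  by (auto simp: mem_box exp_inv_def mult_le_0_iff not_less prod_zero_iff)

lemma bump_tendsto: "(\<lambda>n. bump n a c x) \<longlonglongrightarrow> indicator (box a c) x"
proof -
  have "(\<lambda>n. bump n a c x) \<longlonglongrightarrow> (\<Prod>b\<in>Basis. indicator {0<..} (x \<bullet> b - a \<bullet> b) * indicator {0<..} (c \<bullet> b - x \<bullet> b))"
    unfolding bump_def by (intro tendsto_prod tendsto_mult exp_inv_scaled_tendsto)
  also have "(\<Prod>b\<in>Basis. indicator {0<..} (x \<bullet> b - a \<bullet> b) * indicator {0<..} (c \<bullet> b - x \<bullet> b)) = (indicator (box a c) x :: real)"
    by (auto simp: indicator_def mem_box prod_zero_iff)
  finally show ?thesis .
qed

lemma Ck_bump: "Ck k (bump n a c)"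
  unfolding bump_def[abs_def]
  by (intro Ck_prod Ck_mult Ck_exp_inv Ck_diff Ck_inner Ck_const finite_Basis)

lemma test_function_bump: "test_function (bump n a c)"
  unfolding test_function_def
proof (intro conjI allI Ck_bump)
  have "closure {x. bump n a c x \<noteq> 0} \<subseteq> cbox a c"
    using bump_eq_0[of _ a c n] box_subset_cbox[of a c] by (intro closure_minimal) (auto simp: closed_cbox)
  then show "compact (closure {x. bump n a c x \<noteq> 0})"
    by (meson bounded_cbox bounded_closure bounded_subset closure_subset compact_closure)
qed

lemma test_functionD:
  assumes "test_function \<phi>"
  shows "(\<phi> has_derivative frechet_derivative \<phi> (at x)) (at x)"
    and "continuous_on UNIV \<phi>" and "\<And>b. b \<in> Basis \<Longrightarrow> continuous_on UNIV (\<lambda>x. frechet_derivative \<phi> (at x) b)"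
proof -
  have "Ck 1 \<phi>" "Ck 0 \<phi>" using assms by (auto simp: test_function_def simp del: Ck.simps)
  then show "(\<phi> has_derivative frechet_derivative \<phi> (at x)) (at x)"
    and "continuous_on UNIV \<phi>" and "\<And>b. b \<in> Basis \<Longrightarrow> continuous_on UNIV (\<lambda>x. frechet_derivative \<phi> (at x) b)"
    by (auto simp: frechet_derivative_works)
qed

lemma test_function_mult:
  assumes "test_function \<phi>" and "\<And>k. Ck k f"
  shows "test_function (\<lambda>x. f x * \<phi> x)"
  unfolding test_function_def
proof (intro conjI allI Ck_mult assms)
  have "closure {x. f x * \<phi> x \<noteq> 0} \<subseteq> closure {x. \<phi> x \<noteq> 0}"
    by (rule closure_mono) auto
  then show "compact (closure {x. f x * \<phi> x \<noteq> 0})"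
    using assms(1) unfolding test_function_def
    by (meson compact_imp_bounded bounded_subset closed_closure compact_eq_bounded_closed)
qed (use assms in \<open>auto simp: test_function_def\<close>)

lemma frechet_derivative_eq_0_outside:
  assumes "x \<notin> closure {x. \<phi> x \<noteq> 0}"
  shows "frechet_derivative \<phi> (at x) = (\<lambda>h. 0)"
proof -
  have "((\<lambda>x. 0) has_derivative (\<lambda>h. 0)) (at x)" by simp
  then have "(\<phi> has_derivative (\<lambda>h. 0)) (at x)"
  proof (rule has_derivative_transform_within_open[where s = "- closure {x. \<phi> x \<noteq> 0}"])
    fix z assume "z \<in> - closure {x. \<phi> x \<noteq> 0}"
    then have "z \<notin> {x. \<phi> x \<noteq> 0}" using closure_subset[of "{x. \<phi> x \<noteq> 0}"] by blast
    then show "0 = \<phi> z" by simp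
  qed (use assms in auto)
  then show ?thesis by (simp add: frechet_derivative_at[symmetric])
qed

section \<open>Weak gradients\<close>

text \<open>\<open>locally_integrable\<close> does not mention measurability of f itself; f is
  recovered as the pointwise limit of its truncations to growing balls.\<close>

lemma locally_integrable_measurable:
  assumes "locally_integrable (f :: 'a::euclidean_space \<Rightarrow> 'b::euclidean_space)"
  shows "f \<in> borel_measurable lebesgue"
proof (rule borel_measurable_LIMSEQ_metric)
  show "(\<lambda>x. indicator (cball 0 (real n)) x *\<^sub>R f x) \<in> borel_measurable lebesgue" for n
    using assms unfolding locally_integrable_def set_integrable_def
    by (meson borel_measurable_integrable compact_cball)
  show "(\<lambda>n. indicator (cball 0 (real n)) x *\<^sub>R f x) \<longlonglongrightarrow> f x" for x
  proof (rule tendsto_eventually)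
    show "\<forall>\<^sub>F n in sequentially. indicator (cball 0 (real n)) x *\<^sub>R f x = f x"
      using eventually_ge_at_top[of "nat \<lceil>norm x\<rceil>"] by eventually_elim (auto simp: indicator_def)
  qed
qed

lemma integrable_mult_compact_support:
  fixes f :: "'a::euclidean_space \<Rightarrow> 'b::euclidean_space" and g :: "'a \<Rightarrow> real"
  assumes f: "locally_integrable f" and "compact K" and g: "continuous_on UNIV g"
    and 0: "\<And>x. x \<notin> K \<Longrightarrow> g x = 0"
  shows "integrable lebesgue (\<lambda>x. g x *\<^sub>R f x)"
proof -
  have "compact (g ` K)"
    using \<open>compact K\<close> g by (meson compact_continuous_image continuous_on_subset subset_UNIV)
  then obtain B where B: "\<And>x. x \<in> K \<Longrightarrow> norm (g x) \<le> B"
    by (metis bounded_iff compact_imp_bounded imageI)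
  have i: "integrable lebesgue (\<lambda>x. indicator K x *\<^sub>R f x)"
    using f \<open>compact K\<close> by (auto simp: locally_integrable_def set_integrable_def)
  have [measurable]: "f \<in> borel_measurable lebesgue" "g \<in> borel_measurable lebesgue"
    using f g by (auto simp: locally_integrable_measurable borel_measurable_continuous_onI measurable_completion)
  show ?thesis
  proof (rule Bochner_Integration.integrable_bound)
    show "integrable lebesgue (\<lambda>x. B *\<^sub>R (indicator K x *\<^sub>R f x))"
      using i by (rule integrable_scaleR_right)
    show "AE x in lebesgue. norm (g x *\<^sub>R f x) \<le> norm (B *\<^sub>R (indicator K x *\<^sub>R f x))"
    proof (intro AE_I2)
      fix x show "norm (g x *\<^sub>R f x) \<le> norm (B *\<^sub>R (indicator K x *\<^sub>R f x))"
        using B[of x] 0[of x] by (cases "x \<in> K") (auto intro!: mult_right_mono)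
    qed
  qed measurable
qed

lemma integrable_mult_test_function:
  fixes f :: "'a::euclidean_space \<Rightarrow> real"
  assumes "locally_integrable f" and "test_function \<phi>"
  shows "integrable lebesgue (\<lambda>x. f x * \<phi> x)"
    and "b \<in> Basis \<Longrightarrow> integrable lebesgue (\<lambda>x. f x * frechet_derivative \<phi> (at x) b)"
proof -
  have K: "compact (closure {x. \<phi> x \<noteq> 0})"
    using assms by (auto simp: test_function_def)
  have 0: "\<phi> x = 0" if "x \<notin> closure {x. \<phi> x \<noteq> 0}" for x
    using that closure_subset[of "{x. \<phi> x \<noteq> 0}"] by blast
  show "integrable lebesgue (\<lambda>x. f x * \<phi> x)"
    using integrable_mult_compact_support[OF assms(1) K test_functionD(2)[OF assms(2)] 0]
    by (simp add: mult.commute)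
  show "integrable lebesgue (\<lambda>x. f x * frechet_derivative \<phi> (at x) b)" if "b \<in> Basis"
    using integrable_mult_compact_support[OF assms(1) K test_functionD(3)[OF assms(2) that]]
    by (simp add: frechet_derivative_eq_0_outside mult.commute)
qed

lemma locally_integrable_diff:
  "locally_integrable f \<Longrightarrow> locally_integrable g \<Longrightarrow> locally_integrable (\<lambda>x. f x - g x)"
  by (auto simp: locally_integrable_def intro!: set_integral_diff)

lemma locally_integrable_inner:
  fixes f :: "'a::euclidean_space \<Rightarrow> 'b::euclidean_space"
  assumes "locally_integrable f"
  shows "locally_integrable (\<lambda>x. f x \<bullet> c)"
  unfolding locally_integrable_def set_integrable_def
proof safe
  fix K :: "'a set" assume "compact K"
  then have "integrable lebesgue (\<lambda>x. (indicator K x *\<^sub>R f x) \<bullet> c)"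
    using assms by (intro integrable_inner_left) (auto simp: locally_integrable_def set_integrable_def)
  then show "integrable lebesgue (\<lambda>x. indicator K x *\<^sub>R (f x \<bullet> c))"
    by simp
qed

section \<open>Fundamental lemma of the calculus of variations and uniqueness of weak
  gradients\<close>

text \<open>Borel representatives are required for compositions such as u (x + s h) on a product
  space. The real-valued result for completions is applied to each coordinate.\<close>

lemma lebesgue_ex_borel_measurable:
  fixes f :: "'a::euclidean_space \<Rightarrow> 'b::euclidean_space"
  assumes [measurable]: "f \<in> borel_measurable lebesgue"
  obtains g where "g \<in> borel_measurable borel" "AE x in lborel. f x = g x"
proof -
  have "\<exists>g\<in>borel_measurable lborel. AE x in lborel. f x \<bullet> b = g x" for b
    by (rule completion_ex_borel_measurable_real) measurable
  then obtain g where g: "\<And>b. g b \<in> borel_measurable lborel" "\<And>b. AE x in lborel. f x \<bullet> b = g b x"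
    by metis
  show ?thesis
  proof
    show "(\<lambda>x. \<Sum>b\<in>Basis. g b x *\<^sub>R b) \<in> borel_measurable borel"
      using g(1) by (intro borel_measurable_sum borel_measurable_scaleR) auto
    have "AE x in lborel. \<forall>b\<in>Basis. f x \<bullet> b = g b x"
      by (intro AE_finite_allI finite_Basis g(2))
    then show "AE x in lborel. f x = (\<Sum>b\<in>Basis. g b x *\<^sub>R b)"
      by eventually_elim (metis (no_types, lifting) euclidean_representation sum.cong)
  qed
qed

text \<open>The positive and the negative part of g are densities of two measures with the same
  finite value on every open box. Boxes form an intersection-stable generator, so the measures
  coincide, and uniqueness of densities makes the two parts agree almost everywhere.\<close>

lemma AE_eq_0_if_box_integrals_eq_0:
  fixes g :: "'a::euclidean_space \<Rightarrow> real"
  assumes [measurable]: "g \<in> borel_measurable borel"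
    and int: "\<And>a c. set_integrable lborel (box a c) g"
    and 0: "\<And>a c. (LINT x:box a c|lborel. g x) = 0"
  shows "AE x in lborel. g x = 0"
proof -
  \<comment> \<open>Since \<open>ennreal\<close> maps negative reals to 0, \<open>M 1\<close> has
    the positive part of g as density and \<open>M (-1)\<close> the negative part.\<close>
  define M where "M s = density lborel (\<lambda>x. ennreal (s * g x))" for s :: real
  have fin: "emeasure (M s) (box a c) < \<infinity>" if "s \<in> {-1, 1}" for s a c
  proof -
    have "emeasure (M s) (box a c) \<le> (\<integral>\<^sup>+x. ennreal (norm (indicator (box a c) x *\<^sub>R g x)) \<partial>lborel)"
      unfolding M_def
      by (subst emeasure_density) (use that in \<open>auto intro!: nn_integral_mono simp: indicator_def\<close>)
    also have "\<dots> < \<infinity>"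
      using int[of a c] by (auto simp: set_integrable_def integrable_iff_bounded)
    finally show ?thesis .
  qed
  have "M 1 = M (-1)"
  proof (rule measure_eqI_generator_eq)
    let ?E = "range (\<lambda>(a, b). box a b :: 'a set)"
    show "Int_stable ?E"
      by (auto simp: Int_stable_def box_Int_box)
    show "?E \<subseteq> Pow UNIV" "sets (M 1) = sigma_sets UNIV ?E" "sets (M (-1)) = sigma_sets UNIV ?E"
      by (simp_all add: borel_eq_box M_def)
    show "range (\<lambda>n. box (- (real n *\<^sub>R One)) (real n *\<^sub>R One) :: 'a set) \<subseteq> ?E"
      by auto
    show "(\<Union>n. box (- (real n *\<^sub>R One)) (real n *\<^sub>R One) :: 'a set) = UNIV"
      by (rule UN_box_eq_UNIV)
    show "emeasure (M 1) (box (- (real n *\<^sub>R One)) (real n *\<^sub>R One)) \<noteq> \<infinity>" for n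
      using fin[of 1] by (metis insertCI less_irrefl)
    fix X assume "X \<in> ?E"
    then obtain a c where X: "X = box a c" by auto
    have eq: "emeasure (M s) X = (\<integral>\<^sup>+x. ennreal (s * (indicator X x *\<^sub>R g x)) \<partial>lborel)" for s
      unfolding M_def X by (subst emeasure_density) (auto intro!: nn_integral_cong simp: indicator_def)
    have "enn2real (emeasure (M 1) X) - enn2real (emeasure (M (-1)) X) = 0"
      unfolding eq using int[of a c] 0[of a c] X
      by (simp add: set_integrable_def set_lebesgue_integral_def real_lebesgue_integral_def)
    then show "emeasure (M 1) X = emeasure (M (-1)) X"
      using fin[of 1 a c] fin[of "-1" a c] X
      by (metis eq_iff_diff_eq_0 insertCI ennreal_enn2real infinity_ennreal_def)
  qed
  then have "AE x in lborel. ennreal (1 * g x) = ennreal (- 1 * g x)"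
    unfolding M_def by (intro sigma_finite_measure.density_unique[OF sigma_finite_lborel]) auto
  then show ?thesis
    by eventually_elim (smt (verit) ennreal_eq_0_iff ennreal_inj ennreal_neg)
qed

text \<open>Testing with \<open>bump n a c\<close> and letting n grow gives vanishing integrals over
  open boxes by dominated convergence. The majorant lives on the closed box because local
  integrability speaks about compact sets. The box criterion is then applied to a Borel
  representative.\<close>

lemma AE_eq_0_if_integral_test_functions_eq_0:
  fixes f :: "'a::euclidean_space \<Rightarrow> real"
  assumes f: "locally_integrable f"
    and 0: "\<And>\<phi>. test_function \<phi> \<Longrightarrow> (LINT x|lebesgue. f x * \<phi> x) = 0"
  shows "AE x in lebesgue. f x = 0"
proof -
  have [measurable]: "f \<in> borel_measurable lebesgue"
    using f by (rule locally_integrable_measurable)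
  then obtain g where [measurable]: "g \<in> borel_measurable borel" and g: "AE x in lborel. f x = g x"
    by (rule lebesgue_ex_borel_measurable)
  have g': "AE x in lebesgue. f x = g x" using g by (rule AE_completion)
  have int: "integrable lebesgue (\<lambda>x. indicator (cbox a c) x * f x)" for a c
    using f by (auto simp: locally_integrable_def set_integrable_def)
  have int2: "integrable lebesgue (\<lambda>x. indicator (box a c) x * f x)" for a c
    by (rule Bochner_Integration.integrable_bound[OF int[of a c]])
      (use box_subset_cbox[of a c] in \<open>auto simp: indicator_def intro!: AE_I2
        borel_measurable_times[OF _ locally_integrable_measurable[OF f]] borel_measurable_indicator[unfolded indicator_def[abs_def]]\<close>)
  have box0: "(LINT x|lebesgue. indicator (box a c) x * f x) = 0" for a c
  proof -
    have "(\<lambda>n. LINT x|lebesgue. f x * bump n a c x) \<longlonglongrightarrow> (LINT x|lebesgue. f x * indicator (box a c) x)"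
    proof (rule integral_dominated_convergence)
      show "integrable lebesgue (\<lambda>x. norm (indicator (cbox a c) x * f x))"
        using int by (rule integrable_norm)
      show "AE x in lebesgue. (\<lambda>n. f x * bump n a c x) \<longlonglongrightarrow> f x * indicator (box a c) x"
        by (intro AE_I2 tendsto_mult tendsto_const bump_tendsto)
      show "AE x in lebesgue. norm (f x * bump n a c x) \<le> norm (indicator (cbox a c) x * f x)" for n
      proof (intro AE_I2)
        fix x show "norm (f x * bump n a c x) \<le> norm (indicator (cbox a c) x * f x)"
          using bump_eq_0[of x a c n] bump_bounds[of n a c x] subsetD[OF box_subset_cbox, of x a c]
          by (cases "x \<in> box a c") (auto simp: abs_mult intro!: mult_left_le)
      qed
      show "(\<lambda>x. f x * bump n a c x) \<in> borel_measurable lebesgue" for n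
        using integrable_mult_test_function(1)[OF f test_function_bump] by blast
      show "(\<lambda>x. f x * indicator (box a c) x) \<in> borel_measurable lebesgue"
        using int2[of a c] by (simp add: mult.commute borel_measurable_integrable)
    qed
    then show ?thesis
      using 0[OF test_function_bump] by (simp add: LIMSEQ_const_iff mult.commute)
  qed
  have *: "indicator (box a c) x * f x = indicator (box a c) x * g x" if "f x = g x" for x a c
    using that by simp
  have "AE x in lborel. g x = 0"
  proof (rule AE_eq_0_if_box_integrals_eq_0)
    fix a c
    have "integrable lebesgue (\<lambda>x. indicator (box a c) x * g x)"
      using int2[of a c] by (rule integrable_cong_AE_imp) (use g' in \<open>auto intro: measurable_completion\<close>)
    then show "set_integrable lborel (box a c) g"
      by (simp add: set_integrable_def integrable_completion)
    have "(LINT x|lebesgue. indicator (box a c) x * g x) = (LINT x|lebesgue. indicator (box a c) x * f x)"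
      by (rule integral_cong_AE) (use g' borel_measurable_integrable[OF int2] in \<open>auto intro: measurable_completion\<close>)
    then show "(LINT x:box a c|lborel. g x) = 0"
      using box0[of a c] by (simp add: set_lebesgue_integral_def integral_completion)
  qed measurable
  then have "AE x in lebesgue. g x = 0" by (rule AE_completion)
  with g' show ?thesis by eventually_elim simp
qed

lemma has_weak_gradient_unique:
  assumes "has_weak_gradient u G" "has_weak_gradient u G'"
  shows "AE x in lebesgue. G x = G' x"
proof -
  have "AE x in lebesgue. (G x - G' x) \<bullet> b = 0" if b: "b \<in> Basis" for b
  proof (rule AE_eq_0_if_integral_test_functions_eq_0)
    have li: "locally_integrable (\<lambda>x. G x \<bullet> b)" "locally_integrable (\<lambda>x. G' x \<bullet> b)"
      using assms by (auto simp: has_weak_gradient_def intro: locally_integrable_inner)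
    then show "locally_integrable (\<lambda>x. (G x - G' x) \<bullet> b)"
      unfolding inner_diff_left by (rule locally_integrable_diff)
    fix \<phi> :: "'a \<Rightarrow> real" assume \<phi>: "test_function \<phi>"
    have "(LINT x|lebesgue. (G x - G' x) \<bullet> b * \<phi> x)
        = (LINT x|lebesgue. (G x \<bullet> b) * \<phi> x) - (LINT x|lebesgue. (G' x \<bullet> b) * \<phi> x)"
      unfolding inner_diff_left left_diff_distrib
      by (intro Bochner_Integration.integral_diff integrable_mult_test_function(1) li \<phi>)
    then show "(LINT x|lebesgue. (G x - G' x) \<bullet> b * \<phi> x) = 0"
      using assms \<phi> b unfolding has_weak_gradient_def by fastforce
  qed
  then have "AE x in lebesgue. \<forall>b\<in>Basis. (G x - G' x) \<bullet> b = 0"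
    by (intro AE_finite_allI finite_Basis)
  then show ?thesis
    by eventually_elim (metis euclidean_eqI inner_diff_left right_minus_eq)
qed

lemma has_weak_gradient_weak_gradient:
  "has_weak_gradient u G \<Longrightarrow> has_weak_gradient u (weak_gradient u)"
  unfolding weak_gradient_def by (rule someI[where P = "has_weak_gradient u"])

text \<open>The gradient picked by \<open>SOME\<close> need not be the square-integrable one that
  witnesses membership in \<open>H1\<close>; uniqueness almost everywhere carries square
  integrability over to it.\<close>

lemma H1_D:
  assumes "u \<in> H1"
  shows "u \<in> L2" "has_weak_gradient u (weak_gradient u)" "weak_gradient u \<in> L2"
proof -
  from assms obtain G where G: "u \<in> L2" "has_weak_gradient u G" "G \<in> L2"
    by (auto simp: H1_def)
  show "u \<in> L2" by fact
  show w: "has_weak_gradient u (weak_gradient u)"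
    using G by (rule_tac has_weak_gradient_weak_gradient)
  have m: "weak_gradient u \<in> borel_measurable lebesgue"
    using w by (auto simp: has_weak_gradient_def intro: locally_integrable_measurable)
  moreover have "integrable lebesgue (\<lambda>x. (norm (weak_gradient u x))\<^sup>2)"
  proof (rule integrable_cong_AE_imp)
    show "integrable lebesgue (\<lambda>x. (norm (G x))\<^sup>2)"
      using G by (auto simp: L2_def)
    show "AE x in lebesgue. (norm (G x))\<^sup>2 = (norm (weak_gradient u x))\<^sup>2"
      using has_weak_gradient_unique[OF G(2) w] by eventually_elim simp
  qed (use m in measurable)
  ultimately show "weak_gradient u \<in> L2" by (simp add: L2_def)
qed

section \<open>Difference quotients of functions with a weak gradient\<close>

lemma has_derivative_shift:
  fixes c :: "'a::real_normed_vector"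
  assumes "(f has_derivative f') (at (x - c))"
  shows "((\<lambda>x. f (x - c)) has_derivative f') (at x)"
proof -
  have "((\<lambda>x. x - c) has_derivative (\<lambda>h. h)) (at x)"
    by (auto intro!: derivative_eq_intros)
  from has_derivative_compose[OF this assms] show ?thesis .
qed

lemma Ck_shift: "Ck k f \<Longrightarrow> Ck k (\<lambda>x. f (x - c))"
proof (induction k arbitrary: f)
  case 0
  then show ?case
    by (auto intro!: continuous_on_compose2[of UNIV f] continuous_intros)
next
  case (Suc k)
  show ?case
  proof (rule Ck_SucI)
    show "((\<lambda>x. f (x - c)) has_derivative frechet_derivative f (at (x - c))) (at x)" for x
      using Suc.prems by (intro has_derivative_shift) (simp add: frechet_derivative_works)
    show "Ck k (\<lambda>x. frechet_derivative f (at (x - c)) b)" if "b \<in> Basis" for b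
      using Suc.IH[of "\<lambda>x. frechet_derivative f (at x) b"] Suc.prems that by simp
  qed
qed

lemma test_function_support:
  assumes "test_function \<phi>"
  obtains R where "R > 0" "\<And>x. norm x > R \<Longrightarrow> \<phi> x = 0" "\<And>x b. norm x > R \<Longrightarrow> frechet_derivative \<phi> (at x) b = 0"
proof -
  have "bounded (closure {x. \<phi> x \<noteq> 0})"
    using assms by (auto simp: test_function_def compact_imp_bounded)
  then obtain R where R: "R > 0" "\<And>x. x \<in> closure {x. \<phi> x \<noteq> 0} \<Longrightarrow> norm x \<le> R"
    by (metis bounded_pos)
  show ?thesis
  proof
    show "\<phi> x = 0" if "norm x > R" for x
      using R(2)[of x] that closure_subset[of "{x. \<phi> x \<noteq> 0}"] by force
    show "frechet_derivative \<phi> (at x) b = 0" if "norm x > R" for x b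
      using R(2)[of x] that frechet_derivative_eq_0_outside[of x \<phi>] by force
  qed fact
qed

lemma test_functionI:
  assumes "\<And>k. Ck k \<phi>" "\<And>x. norm x > R \<Longrightarrow> \<phi> x = 0"
  shows "test_function \<phi>"
proof -
  have "closure {x. \<phi> x \<noteq> 0} \<subseteq> cball 0 R"
    using assms(2) by (intro closure_minimal subsetI) (auto simp: not_less[symmetric])
  then have "compact (closure {x. \<phi> x \<noteq> 0})"
    by (meson bounded_cball bounded_subset closed_closure compact_eq_bounded_closed)
  then show ?thesis using assms(1) by (auto simp: test_function_def)
qed

lemma test_function_shift:
  assumes "test_function \<phi>"
  shows "test_function (\<lambda>x. \<phi> (x - c))"
proof -
  obtain R where R: "\<And>x. norm x > R \<Longrightarrow> \<phi> x = 0"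
    using test_function_support[OF assms] by metis
  show ?thesis
  proof (rule test_functionI)
    show "Ck k (\<lambda>x. \<phi> (x - c))" for k
      using assms by (intro Ck_shift) (auto simp: test_function_def)
    show "\<phi> (x - c) = 0" if "norm x > R + norm c" for x
    proof -
      have "norm (x - c) > R"
        using that norm_triangle_ineq2[of x c] by simp
      then show ?thesis by (rule R)
    qed
  qed
qed

lemma compact_support_bounded:
  fixes g :: "'a::euclidean_space \<Rightarrow> real"
  assumes "continuous_on UNIV g" "\<And>x. norm x > R \<Longrightarrow> g x = 0"
  obtains B where "B \<ge> 0" "\<And>x. \<bar>g x\<bar> \<le> B"
proof -
  have "compact (g ` cball 0 R)"
    using assms(1) by (meson compact_cball compact_continuous_image continuous_on_subset subset_UNIV)
  then obtain B where B: "\<And>x. x \<in> cball 0 R \<Longrightarrow> norm (g x) \<le> B"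
    by (metis bounded_iff compact_imp_bounded imageI)
  have "\<bar>g x\<bar> \<le> max B 0" for x
    using B[of x] assms(2)[of x] by (cases "norm x \<le> R") auto
  then show ?thesis using that[of "max B 0"] by auto
qed

lemma lborel_shift:
  fixes f :: "'a::euclidean_space \<Rightarrow> ennreal" and c :: 'a
  assumes [measurable]: "f \<in> borel_measurable borel"
  shows "(\<integral>\<^sup>+x. f (x + c) \<partial>lborel) = (\<integral>\<^sup>+x. f x \<partial>lborel)"
proof -
  have "(\<integral>\<^sup>+x. f x \<partial>lborel) = (\<integral>\<^sup>+x. f x \<partial>distr lborel borel ((+) c))"
    by (simp add: lborel_distr_plus)
  also have "\<dots> = (\<integral>\<^sup>+x. f (c + x) \<partial>lborel)"
    by (subst nn_integral_distr) auto
  finally show ?thesis by (simp add: add.commute)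
qed

lemma lborel_integral_shift:
  fixes f :: "'a::euclidean_space \<Rightarrow> real" and c :: 'a
  assumes [measurable]: "f \<in> borel_measurable borel"
  shows "(LINT x|lborel. f (x + c)) = (LINT x|lborel. f x)"
proof -
  have "(LINT x|lborel. f x) = (LINT x|distr lborel borel ((+) c). f x)"
    by (simp add: lborel_distr_plus)
  also have "\<dots> = (LINT x|lborel. f (c + x))"
    by (subst integral_distr) auto
  finally show ?thesis by (simp add: add.commute)
qed

lemma lborel_integrable_shift:
  fixes f :: "'a::euclidean_space \<Rightarrow> real" and c :: 'a
  assumes "integrable lborel f"
  shows "integrable lborel (\<lambda>x. f (x + c))"
proof -
  have "integrable (distr lborel borel ((+) c)) f"
    using assms by (simp add: lborel_distr_plus)
  then have "integrable lborel (\<lambda>x. f (c + x))"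
    by (rule integrable_distr[rotated]) simp
  then show ?thesis by (simp add: add.commute)
qed

lemma locally_integrable_lborel:
  fixes g :: "'a::euclidean_space \<Rightarrow> 'b::euclidean_space"
  assumes [measurable]: "g \<in> borel_measurable borel"
  shows "locally_integrable g \<longleftrightarrow> (\<forall>K. compact K \<longrightarrow> integrable lborel (\<lambda>x. indicator K x *\<^sub>R g x))"
proof -
  have "integrable lebesgue (\<lambda>x. indicator K x *\<^sub>R g x) \<longleftrightarrow> integrable lborel (\<lambda>x. indicator K x *\<^sub>R g x)"
    if "compact K" for K :: "'a set"
  proof -
    have [measurable]: "K \<in> sets borel" using that by (simp add: borel_compact)
    show ?thesis by (rule integrable_completion) measurable
  qed
  then show ?thesis by (auto simp: locally_integrable_def set_integrable_def)
qed

text \<open>For s in [0,1] all shifted supports of \<psi> lie in one ball of radius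
  \<open>R + norm h\<close>, so only the integral of |g| over that compact set enters. This bounds
  the inner integral uniformly in s, and s ranges over an interval of length 1. The second integrand
  is a translate of the first for each fixed s.\<close>

lemma integrable_pair_sheared:
  fixes g \<psi> :: "'a::euclidean_space \<Rightarrow> real" and h :: 'a
  assumes g: "locally_integrable g" and [measurable]: "g \<in> borel_measurable borel" "\<psi> \<in> borel_measurable borel"
    and B: "B \<ge> 0" "\<And>x. \<bar>\<psi> x\<bar> \<le> B" and R: "\<And>x. norm x > R \<Longrightarrow> \<psi> x = 0"
  shows "integrable (lborel \<Otimes>\<^sub>M lborel) (\<lambda>(s, x). indicator {0..1::real} s * (g x * \<psi> (x - s *\<^sub>R h)))"
    and "integrable (lborel \<Otimes>\<^sub>M lborel) (\<lambda>(s, x). indicator {0..1::real} s * (g (x + s *\<^sub>R h) * \<psi> x))"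
proof -
  let ?K = "cball 0 (R + norm h) :: 'a set"
  define C where "C = (\<integral>\<^sup>+x. ennreal (B * norm (indicator ?K x *\<^sub>R g x)) \<partial>lborel)"
  have "integrable lborel (\<lambda>x. indicator ?K x *\<^sub>R g x)"
    using g by (auto simp: locally_integrable_lborel)
  then have "integrable lborel (\<lambda>x. B * norm (indicator ?K x *\<^sub>R g x))"
    by (intro integrable_mult_right integrable_norm)
  then have "(\<integral>\<^sup>+x. ennreal (norm (B * norm (indicator ?K x *\<^sub>R g x))) \<partial>lborel) < \<infinity>"
    unfolding integrable_iff_bounded by blast
  moreover have "norm (B * norm (indicator ?K x *\<^sub>R g x)) = B * norm (indicator ?K x *\<^sub>R g x)" for x
    using B(1) by simp
  ultimately have "C < \<infinity>" unfolding C_def by simp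
  have 1: "(\<integral>\<^sup>+x. ennreal (norm (indicator {0..1} s * (g x * \<psi> (x - s *\<^sub>R h)))) \<partial>lborel) \<le> C * indicator {0..1} s"
    for s :: real
  proof (cases "s \<in> {0..1}")
    case True
    have "norm (g x * \<psi> (x - s *\<^sub>R h)) \<le> B * norm (indicator ?K x *\<^sub>R g x)" for x
    proof (cases "x \<in> ?K")
      case True
      then show ?thesis using B(2)[of "x - s *\<^sub>R h"] by (simp add: abs_mult mult.commute[of "\<bar>g x\<bar>"] mult_right_mono)
    next
      case False
      have "norm (s *\<^sub>R h) \<le> norm h" using \<open>s \<in> {0..1}\<close> by (simp add: mult_left_le_one_le)
      then have "norm (x - s *\<^sub>R h) > R"
        using False norm_triangle_ineq2[of x "s *\<^sub>R h"] by simp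
      then show ?thesis using R B(1) by simp
    qed
    then show ?thesis
      using True unfolding C_def by (auto intro!: nn_integral_mono ennreal_leI)
  qed simp
  have 2: "(\<integral>\<^sup>+x. ennreal (norm (indicator {0..1} s * (g (x + s *\<^sub>R h) * \<psi> x))) \<partial>lborel) \<le> C * indicator {0..1} s"
    for s :: real
  proof -
    have "(\<integral>\<^sup>+x. ennreal (norm (indicator {0..1} s * (g (x + s *\<^sub>R h) * \<psi> x))) \<partial>lborel)
       = (\<integral>\<^sup>+x. ennreal (norm (indicator {0..1} s * (g x * \<psi> (x - s *\<^sub>R h)))) \<partial>lborel)"
      using lborel_shift[of "\<lambda>x. ennreal (norm (indicator {0..1} s * (g x * \<psi> (x - s *\<^sub>R h))))" "s *\<^sub>R h"]
      by simp
    then show ?thesis using 1[of s] by simp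
  qed
  have *: "integrable (lborel \<Otimes>\<^sub>M lborel) F"
    if [measurable]: "F \<in> borel_measurable (lborel \<Otimes>\<^sub>M lborel)"
      and le: "\<And>s. (\<integral>\<^sup>+x. ennreal (norm (F (s, x))) \<partial>lborel) \<le> C * indicator {0..1} s"
    for F :: "real \<times> 'a \<Rightarrow> real"
  proof (rule integrableI_bounded)
    have "(\<integral>\<^sup>+z. ennreal (norm (F z)) \<partial>(lborel \<Otimes>\<^sub>M lborel)) = (\<integral>\<^sup>+s. \<integral>\<^sup>+x. ennreal (norm (F (s, x))) \<partial>lborel \<partial>lborel)"
      by (rule lborel.nn_integral_fst[symmetric]) measurable
    also have "\<dots> \<le> (\<integral>\<^sup>+s. C * indicator {0..1::real} s \<partial>lborel)"
      by (intro nn_integral_mono le)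
    also have "\<dots> = C" by (subst nn_integral_cmult_indicator) auto
    finally show "(\<integral>\<^sup>+z. ennreal (norm (F z)) \<partial>(lborel \<Otimes>\<^sub>M lborel)) < \<infinity>"
      using \<open>C < \<infinity>\<close> by simp
  qed fact
  show "integrable (lborel \<Otimes>\<^sub>M lborel) (\<lambda>(s, x). indicator {0..1::real} s * (g x * \<psi> (x - s *\<^sub>R h)))"
    by (rule *) (use 1 in \<open>auto\<close>)
  show "integrable (lborel \<Otimes>\<^sub>M lborel) (\<lambda>(s, x). indicator {0..1::real} s * (g (x + s *\<^sub>R h) * \<psi> x))"
    by (rule *) (use 2 in \<open>auto\<close>)
qed

text \<open>Fubini in (s, x) combined with the substitution x -> x + s h moves the average over a
  segment from the test function to g. This is the device that transports the fundamental theorem of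
  calculus from test functions to weakly differentiable functions.\<close>

lemma LINT_mult_swap:
  fixes g \<psi> :: "'a::euclidean_space \<Rightarrow> real" and h :: 'a
  assumes g: "locally_integrable g" and [measurable]: "g \<in> borel_measurable borel" "\<psi> \<in> borel_measurable borel"
    and B: "B \<ge> 0" "\<And>x. \<bar>\<psi> x\<bar> \<le> B" and R: "\<And>x. norm x > R \<Longrightarrow> \<psi> x = 0"
  shows "(LINT x|lborel. g x * (LINT s:{0..1}|lborel. \<psi> (x - s *\<^sub>R h)))
      = (LINT s:{0..1}|lborel. (LINT x|lborel. g x * \<psi> (x - s *\<^sub>R h)))" (is ?A)
    and "(LINT s:{0..1}|lborel. (LINT x|lborel. g x * \<psi> (x - s *\<^sub>R h)))
      = (LINT x|lborel. (LINT s:{0..1}|lborel. g (x + s *\<^sub>R h)) * \<psi> x)" (is ?B)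
    and "integrable lborel (\<lambda>x. (LINT s:{0..1}|lborel. g (x + s *\<^sub>R h)) * \<psi> x)"
proof -
  note i = integrable_pair_sheared[OF assms(1-6), where h = h]
  have "(LINT s|lborel. (LINT x|lborel. indicator {0..1} s * (g x * \<psi> (x - s *\<^sub>R h))))
     = (LINT x|lborel. (LINT s|lborel. indicator {0..1} s * (g x * \<psi> (x - s *\<^sub>R h))))"
    using lborel_pair.Fubini_integral[OF i(1)[folded case_prod_beta'], symmetric] by simp
  moreover have "(LINT s|lborel. indicator {0..1} s * (g x * \<psi> (x - s *\<^sub>R h)))
      = g x * (LINT s:{0..1}|lborel. \<psi> (x - s *\<^sub>R h))" for x
    unfolding set_lebesgue_integral_def
    by (subst integral_mult_right_zero[symmetric]) (simp add: mult_ac)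
  ultimately show ?A by (simp add: set_lebesgue_integral_def)
  have 3: "(LINT s|lborel. indicator {0..1} s * (g (x + s *\<^sub>R h) * \<psi> x))
      = (LINT s:{0..1}|lborel. g (x + s *\<^sub>R h)) * \<psi> x" for x
    unfolding set_lebesgue_integral_def
    by (subst integral_mult_left_zero[symmetric]) (simp add: mult_ac)
  have "(LINT s:{0..1}|lborel. (LINT x|lborel. g x * \<psi> (x - s *\<^sub>R h)))
      = (LINT s|lborel. (LINT x|lborel. indicator {0..1} s * (g (x + s *\<^sub>R h) * \<psi> x)))"
    unfolding set_lebesgue_integral_def
  proof (intro Bochner_Integration.integral_cong refl)
    fix s :: real
    show "indicator {0..1} s *\<^sub>R (LINT x|lborel. g x * \<psi> (x - s *\<^sub>R h))
      = (LINT x|lborel. indicator {0..1} s * (g (x + s *\<^sub>R h) * \<psi> x))"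
      using lborel_integral_shift[of "\<lambda>x. g x * \<psi> (x - s *\<^sub>R h)" "s *\<^sub>R h"] by simp
  qed
  also have "\<dots> = (LINT x|lborel. (LINT s|lborel. indicator {0..1} s * (g (x + s *\<^sub>R h) * \<psi> x)))"
    using lborel_pair.Fubini_integral[OF i(2), symmetric] by simp
  finally show ?B by (simp add: 3)
  show "integrable lborel (\<lambda>x. (LINT s:{0..1}|lborel. g (x + s *\<^sub>R h)) * \<psi> x)"
    using lborel_pair.integrable_snd[OF i(2)] by (simp add: 3)
qed

lemma frechet_derivative_test_function_eq_sum:
  assumes "test_function \<phi>"
  shows "frechet_derivative \<phi> (at x) h = (\<Sum>b\<in>Basis. (h \<bullet> b) * frechet_derivative \<phi> (at x) b)"
proof -
  interpret linear "frechet_derivative \<phi> (at x)"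
    using test_functionD(1)[OF assms] by (rule has_derivative_linear)
  show ?thesis
    using sum[of "\<lambda>b. (h \<bullet> b) *\<^sub>R b" Basis] by (simp add: euclidean_representation scale)
qed

lemma has_weak_gradient_directional:
  assumes w: "has_weak_gradient u G" and \<phi>: "test_function \<phi>"
  shows "(LINT x|lebesgue. u x * frechet_derivative \<phi> (at x) h) = - (LINT x|lebesgue. (G x \<bullet> h) * \<phi> x)"
proof -
  have lu: "locally_integrable u" and lG: "locally_integrable G"
    using w by (auto simp: has_weak_gradient_def)
  note lin = frechet_derivative_test_function_eq_sum[OF \<phi>, where h = h]
  have Gh: "G x \<bullet> h = (\<Sum>b\<in>Basis. (h \<bullet> b) * (G x \<bullet> b))" for x
    by (subst euclidean_inner) (simp add: mult.commute)
  have "(LINT x|lebesgue. u x * frechet_derivative \<phi> (at x) h)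
      = (LINT x|lebesgue. (\<Sum>b\<in>Basis. (h \<bullet> b) * (u x * frechet_derivative \<phi> (at x) b)))"
    by (simp add: lin sum_distrib_left mult_ac)
  also have "\<dots> = (\<Sum>b\<in>Basis. (h \<bullet> b) * (LINT x|lebesgue. u x * frechet_derivative \<phi> (at x) b))"
    by (subst Bochner_Integration.integral_sum)
      (auto intro!: integrable_mult_right integrable_mult_test_function(2) lu \<phi>)
  also have "\<dots> = - (\<Sum>b\<in>Basis. (h \<bullet> b) * (LINT x|lebesgue. (G x \<bullet> b) * \<phi> x))"
    using w \<phi> by (auto simp: has_weak_gradient_def sum_negf[symmetric] intro!: sum.cong)
  also have "(\<Sum>b\<in>Basis. (h \<bullet> b) * (LINT x|lebesgue. (G x \<bullet> b) * \<phi> x))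
      = (LINT x|lebesgue. (\<Sum>b\<in>Basis. (h \<bullet> b) * ((G x \<bullet> b) * \<phi> x)))"
    by (subst Bochner_Integration.integral_sum)
      (auto intro!: integrable_mult_right integrable_mult_test_function(1) locally_integrable_inner lG \<phi>)
  also have "\<dots> = (LINT x|lebesgue. (G x \<bullet> h) * \<phi> x)"
    by (simp add: Gh sum_distrib_left mult_ac)
  finally show ?thesis .
qed

lemma has_weak_gradient_directional_shift:
  assumes w: "has_weak_gradient u G" and \<phi>: "test_function \<phi>"
  shows "(LINT x|lebesgue. u x * frechet_derivative \<phi> (at (x - c)) h) = - (LINT x|lebesgue. (G x \<bullet> h) * \<phi> (x - c))"
proof -
  have "frechet_derivative (\<lambda>x. \<phi> (x - c)) (at x) = frechet_derivative \<phi> (at (x - c))" for x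
    using has_derivative_shift[OF test_functionD(1)[OF \<phi>, of "x - c"]] by (simp add: frechet_derivative_at[symmetric])
  then show ?thesis
    using has_weak_gradient_directional[OF w test_function_shift[OF \<phi>, of c]] by simp
qed

lemma test_function_directional:
  assumes \<phi>: "test_function \<phi>"
  shows "continuous_on UNIV (\<lambda>x. frechet_derivative \<phi> (at x) h)"
  unfolding frechet_derivative_test_function_eq_sum[OF \<phi>, where h = h]
  by (intro continuous_intros test_functionD(3)[OF \<phi>])

lemma test_function_shift_diff:
  assumes \<phi>: "test_function \<phi>"
  shows "\<phi> (x - h) - \<phi> x = - (LINT s:{0..1}|lborel. frechet_derivative \<phi> (at (x - s *\<^sub>R h)) h)"
proof -
  have "((\<lambda>s. \<phi> (x - s *\<^sub>R h)) has_vector_derivative - frechet_derivative \<phi> (at (x - s *\<^sub>R h)) h) (at s within {0..1})" for s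
  proof -
    interpret linear "frechet_derivative \<phi> (at (x - s *\<^sub>R h))"
      using test_functionD(1)[OF \<phi>] by (rule has_derivative_linear)
    have "((\<lambda>s. x - s *\<^sub>R h) has_derivative (\<lambda>t. - (t *\<^sub>R h))) (at s within {0..1})"
      by (auto intro!: derivative_eq_intros)
    from has_derivative_compose[OF this test_functionD(1)[OF \<phi>]]
    show ?thesis
      by (simp add: has_vector_derivative_def neg scale)
  qed
  moreover have c: "continuous_on {0..1} (\<lambda>s. - frechet_derivative \<phi> (at (x - s *\<^sub>R h)) h)"
    by (intro continuous_on_minus continuous_on_compose2[OF test_function_directional[OF \<phi>]] continuous_intros) auto
  ultimately have "(LINT s:{0..1}|lborel. - frechet_derivative \<phi> (at (x - s *\<^sub>R h)) h) = \<phi> (x - 1 *\<^sub>R h) - \<phi> (x - 0 *\<^sub>R h)"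
    unfolding set_lebesgue_integral_def by (intro integral_FTC_atLeastAtMost) auto
  then show ?thesis by (simp add: set_lebesgue_integral_def)
qed

text \<open>Both sides are tested against \<phi>: the translation is moved onto \<phi>, whose
  difference is an integral along a segment; the definition of the weak gradient applies for each s,
  and \<open>LINT_mult_swap\<close> moves the average back to G. No mollification is involved. The
  exceptional null set may depend on h, which is harmless as h is fixed in the integrals that
  follow.\<close>

lemma weak_gradient_difference:
  fixes u :: "'a::euclidean_space \<Rightarrow> real"
  assumes w: "has_weak_gradient u G" and [measurable]: "u \<in> borel_measurable borel" "G \<in> borel_measurable borel"
  shows "AE x in lborel. u (x + h) - u x = (LINT s:{0..1}|lborel. G (x + s *\<^sub>R h) \<bullet> h)"
proof -
  define H where "H x = (LINT s:{0..1}|lborel. G (x + s *\<^sub>R h) \<bullet> h)" for x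
  have lu: "locally_integrable u" and lG: "locally_integrable (\<lambda>x. G x \<bullet> h)"
    using w by (auto simp: has_weak_gradient_def intro: locally_integrable_inner)
  have [measurable]: "H \<in> borel_measurable borel"
    unfolding H_def set_lebesgue_integral_def by measurable
  have lH: "locally_integrable H"
    unfolding locally_integrable_lborel[OF \<open>H \<in> borel_measurable borel\<close>]
  proof safe
    fix K :: "'a set" assume K: "compact K"
    then have [measurable]: "K \<in> sets borel" by (simp add: borel_compact)
    obtain R where R: "\<And>x. x \<in> K \<Longrightarrow> norm x \<le> R"
      using K by (meson bounded_iff compact_imp_bounded)
    \<comment> \<open>The swapping lemma allows any bounded Borel \<psi> with bounded support, so
      the indicator of K can take the place of a test function.\<close>
    have "integrable lborel (\<lambda>x. H x * indicator K x)"
      unfolding H_def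
      by (rule LINT_mult_swap(3)[OF lG, of _ 1 R]) (use R in \<open>force simp: indicator_def\<close>)+
    then show "integrable lborel (\<lambda>x. indicator K x *\<^sub>R H x)"
      by (simp add: mult.commute)
  qed
  have lsh: "locally_integrable (\<lambda>x. u (x + h))"
  proof -
    have "integrable lborel (\<lambda>x. indicator K x *\<^sub>R u (x + h))" if K: "compact K" for K
    proof -
      have "compact ((+) h ` K)" using K by (rule compact_translation)
      then have "integrable lborel (\<lambda>x. indicator ((+) h ` K) x *\<^sub>R u x)"
        using lu by (simp add: locally_integrable_lborel)
      from lborel_integrable_shift[OF this, of h]
      show ?thesis
        by (rule Bochner_Integration.integrable_cong[THEN iffD1, rotated -1])
          (auto simp: indicator_def add.commute)
    qed
    then show ?thesis by (simp add: locally_integrable_lborel)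
  qed
  have lf: "locally_integrable (\<lambda>x. u (x + h) - u x - H x)"
    by (intro locally_integrable_diff lsh lu lH)
  have "AE x in lebesgue. u (x + h) - u x - H x = 0"
  proof (rule AE_eq_0_if_integral_test_functions_eq_0[OF lf])
    fix \<phi> :: "'a \<Rightarrow> real" assume \<phi>: "test_function \<phi>"
    let ?D = "\<lambda>x. frechet_derivative \<phi> (at x) h"
    obtain R where R: "\<And>x. norm x > R \<Longrightarrow> \<phi> x = 0" "\<And>x. norm x > R \<Longrightarrow> ?D x = 0"
      using test_function_support[OF \<phi>] by metis
    have c\<phi>: "continuous_on UNIV \<phi>" and cD: "continuous_on UNIV ?D"
      using test_functionD[OF \<phi>] test_function_directional[OF \<phi>] by auto
    then have [measurable]: "\<phi> \<in> borel_measurable borel" "?D \<in> borel_measurable borel"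
      by (auto intro: borel_measurable_continuous_onI)
    obtain B where B: "B \<ge> 0" "\<And>x. \<bar>\<phi> x\<bar> \<le> B"
      using compact_support_bounded[OF c\<phi> R(1)] by metis
    obtain B' where B': "B' \<ge> 0" "\<And>x. \<bar>?D x\<bar> \<le> B'"
      using compact_support_bounded[OF cD R(2)] by metis
    note i = integrable_mult_test_function(1)[OF _ \<phi>]
    have i': "integrable lborel (\<lambda>x. u x * \<phi> x)" "integrable lborel (\<lambda>x. u (x + h) * \<phi> x)"
      "integrable lborel (\<lambda>x. u x * \<phi> (x - h))"
      using i[OF lu] i[OF lsh] integrable_mult_test_function(1)[OF lu test_function_shift[OF \<phi>]]
      by (auto simp: integrable_completion)
    have "(LINT x|lborel. u (x + h) * \<phi> x) - (LINT x|lborel. u x * \<phi> x)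
        = (LINT x|lborel. u x * \<phi> (x - h)) - (LINT x|lborel. u x * \<phi> x)"
      using lborel_integral_shift[of "\<lambda>x. u x * \<phi> (x - h)" h] by simp
    also have "\<dots> = (LINT x|lborel. u x * (\<phi> (x - h) - \<phi> x))"
      using i' by (simp add: right_diff_distrib)
    also have "\<dots> = - (LINT x|lborel. u x * (LINT s:{0..1}|lborel. ?D (x - s *\<^sub>R h)))"
      by (simp add: test_function_shift_diff[OF \<phi>])
    also have "\<dots> = - (LINT s:{0..1}|lborel. (LINT x|lborel. u x * ?D (x - s *\<^sub>R h)))"
      by (subst LINT_mult_swap(1)[OF lu _ _ B' R(2)]) auto
    also have "\<dots> = (LINT s:{0..1}|lborel. (LINT x|lborel. (G x \<bullet> h) * \<phi> (x - s *\<^sub>R h)))"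
    proof -
      have "(LINT x|lborel. u x * ?D (x - s *\<^sub>R h)) = - (LINT x|lborel. (G x \<bullet> h) * \<phi> (x - s *\<^sub>R h))" for s
        using has_weak_gradient_directional_shift[OF w \<phi>, of "s *\<^sub>R h" h] by (simp add: integral_completion)
      then show ?thesis by (simp add: set_lebesgue_integral_def)
    qed
    also have "\<dots> = (LINT x|lborel. H x * \<phi> x)"
      unfolding H_def by (rule LINT_mult_swap(2)[OF lG _ _ B R(1)]) auto
    finally have "(LINT x|lborel. u (x + h) * \<phi> x) - (LINT x|lborel. u x * \<phi> x) - (LINT x|lborel. H x * \<phi> x) = 0"
      by simp
    moreover have "integrable lborel (\<lambda>x. H x * \<phi> x)"
      using i[OF lH] by (simp add: integrable_completion)
    ultimately show "(LINT x|lebesgue. (u (x + h) - u x - H x) * \<phi> x) = 0"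
      using i' by (simp add: integral_completion left_diff_distrib)
  qed
  then have "AE x in lborel. u (x + h) - u x - H x = 0"
    by (simp add: AE_completion_iff)
  then show ?thesis by eventually_elim (simp add: H_def)
qed

text \<open>Jensen on the unit interval, obtained by integrating (f - m)^2 >= 0 with m the mean of
  f. Stating it with a nonnegative integral on the right removes all integrability hypotheses: if
  f^2 is not integrable the right-hand side is infinite, and otherwise |t| <= 1 + t^2 makes f
  integrable.\<close>

lemma square_integral_le:
  fixes f :: "real \<Rightarrow> real"
  assumes [measurable]: "f \<in> borel_measurable borel"
  shows "ennreal ((LINT s:{0..1}|lborel. f s)\<^sup>2) \<le> (\<integral>\<^sup>+s. indicator {0..1} s * ennreal ((f s)\<^sup>2) \<partial>lborel)"
proof (cases "integrable lborel (\<lambda>s. indicator {0..1} s *\<^sub>R f s) \<and> integrable lborel (\<lambda>s. indicator {0..1} s * (f s)\<^sup>2)")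
  case True
  define m where "m = (LINT s|lborel. indicator {0..1} s *\<^sub>R f s)"
  have "2 * m * m - m\<^sup>2 = (LINT s|lborel. 2 * m * (indicator {0..1} s *\<^sub>R f s) - m\<^sup>2 * indicator {0..1} s)"
    using True by (subst Bochner_Integration.integral_diff) (auto simp: m_def)
  also have "\<dots> \<le> (LINT s|lborel. indicator {0..1} s * (f s)\<^sup>2)"
  proof (rule integral_mono)
    fix s
    have "0 \<le> (f s - m)\<^sup>2" by simp
    then show "2 * m * (indicator {0..1} s *\<^sub>R f s) - m\<^sup>2 * indicator {0..1} s \<le> indicator {0..1} s * (f s)\<^sup>2"
      by (auto simp: indicator_def power2_diff mult_ac)
  qed (use True in auto)
  finally have "m\<^sup>2 \<le> (LINT s|lborel. indicator {0..1} s * (f s)\<^sup>2)"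
    by (simp add: power2_eq_square)
  then have "ennreal (m\<^sup>2) \<le> (\<integral>\<^sup>+s. ennreal (indicator {0..1} s * (f s)\<^sup>2) \<partial>lborel)"
    using True by (subst nn_integral_eq_integral) (auto simp: ennreal_leI)
  also have "\<dots> = (\<integral>\<^sup>+s. indicator {0..1} s * ennreal ((f s)\<^sup>2) \<partial>lborel)"
    by (intro nn_integral_cong) (auto simp: indicator_def)
  finally show ?thesis by (simp add: m_def set_lebesgue_integral_def)
next
  case False
  show ?thesis
  proof (cases "integrable lborel (\<lambda>s. indicator {0..1} s * (f s)\<^sup>2)")
    case True
    have "integrable lborel (\<lambda>s. indicator {0..1} s *\<^sub>R f s)"
    proof (rule Bochner_Integration.integrable_bound)
      show "integrable lborel (\<lambda>s. indicator {0..1} s + indicator {0..1} s * (f s)\<^sup>2)"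
        using True by auto
      have "\<bar>t\<bar> \<le> 1 + t\<^sup>2" for t :: real
      proof -
        have "(\<bar>t\<bar> - 1 / 2)\<^sup>2 = t\<^sup>2 - \<bar>t\<bar> + 1 / 4" by (simp add: power2_diff power_divide)
        then show ?thesis using zero_le_power2[of "\<bar>t\<bar> - 1 / 2"] by linarith
      qed
      then show "AE s in lborel. norm (indicator {0..1} s *\<^sub>R f s) \<le> norm (indicator {0..1} s + indicator {0..1} s * (f s)\<^sup>2)"
        by (auto simp: indicator_def)
    qed measurable
    with False True show ?thesis by simp
  next
    case False
    have "(\<integral>\<^sup>+s. indicator {0..1} s * ennreal ((f s)\<^sup>2) \<partial>lborel) = (\<integral>\<^sup>+s. ennreal (norm (indicator {0..1} s * (f s)\<^sup>2)) \<partial>lborel)"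
      by (intro nn_integral_cong) (auto simp: indicator_def)
    also have "\<dots> = \<infinity>"
      using False by (auto simp: integrable_iff_bounded less_top[symmetric])
    finally show ?thesis by simp
  qed
qed

text \<open>Jensen along the segment, then Tonelli; for each s translation invariance removes the
  shift, and the integral over s is over an interval of length 1.\<close>

lemma weak_gradient_translation:
  fixes u :: "'a::euclidean_space \<Rightarrow> real"
  assumes w: "has_weak_gradient u G" and [measurable]: "u \<in> borel_measurable borel" "G \<in> borel_measurable borel"
  shows "(\<integral>\<^sup>+x. ennreal ((u (x + h) - u x)\<^sup>2) \<partial>lborel)
     \<le> ennreal ((norm h)\<^sup>2) * (\<integral>\<^sup>+x. ennreal ((norm (G x))\<^sup>2) \<partial>lborel)"
proof -
  have "(\<integral>\<^sup>+x. ennreal ((u (x + h) - u x)\<^sup>2) \<partial>lborel)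
      = (\<integral>\<^sup>+x. ennreal ((LINT s:{0..1}|lborel. G (x + s *\<^sub>R h) \<bullet> h)\<^sup>2) \<partial>lborel)"
    using weak_gradient_difference[OF assms, of h] by (intro nn_integral_cong_AE) auto
  also have "\<dots> \<le> (\<integral>\<^sup>+x. \<integral>\<^sup>+s. indicator {0..1::real} s * ennreal ((G (x + s *\<^sub>R h) \<bullet> h)\<^sup>2) \<partial>lborel \<partial>lborel)"
    by (intro nn_integral_mono square_integral_le) measurable
  also have "\<dots> = (\<integral>\<^sup>+s. \<integral>\<^sup>+x. indicator {0..1::real} s * ennreal ((G (x + s *\<^sub>R h) \<bullet> h)\<^sup>2) \<partial>lborel \<partial>lborel)"
    by (rule lborel_pair.Fubini') measurable
  also have "\<dots> = (\<integral>\<^sup>+s. indicator {0..1::real} s * (\<integral>\<^sup>+x. ennreal ((G x \<bullet> h)\<^sup>2) \<partial>lborel) \<partial>lborel)"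
    using lborel_shift[of "\<lambda>x. ennreal ((G x \<bullet> h)\<^sup>2)"]
    by (intro nn_integral_cong) (simp add: nn_integral_cmult)
  also have "\<dots> = (\<integral>\<^sup>+x. ennreal ((G x \<bullet> h)\<^sup>2) \<partial>lborel)"
    by (subst nn_integral_multc) auto
  also have "\<dots> \<le> (\<integral>\<^sup>+x. ennreal ((norm h)\<^sup>2) * ennreal ((norm (G x))\<^sup>2) \<partial>lborel)"
  proof (intro nn_integral_mono)
    fix x
    have "(G x \<bullet> h)\<^sup>2 \<le> (norm (G x) * norm h)\<^sup>2"
      using Cauchy_Schwarz_ineq2[of "G x" h] by (metis abs_ge_zero power2_abs power_mono)
    then show "ennreal ((G x \<bullet> h)\<^sup>2) \<le> ennreal ((norm h)\<^sup>2) * ennreal ((norm (G x))\<^sup>2)"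
      by (simp add: ennreal_mult[symmetric] power_mult_distrib mult.commute ennreal_leI)
  qed
  also have "\<dots> = ennreal ((norm h)\<^sup>2) * (\<integral>\<^sup>+x. ennreal ((norm (G x))\<^sup>2) \<partial>lborel)"
    by (rule nn_integral_cmult) measurable
  finally show ?thesis .
qed

section \<open>Subcritical Sobolev bounds\<close>

text \<open>Borel representatives of functions in the unit ball of \<open>H\<^sup>1\<close>; only the bound on difference
  quotients enters the embedding below.\<close>

definition sobolev_unit :: "('a::euclidean_space \<Rightarrow> real) \<Rightarrow> bool" where
  "sobolev_unit u \<longleftrightarrow> u \<in> borel_measurable borel \<and> (\<integral>\<^sup>+x. ennreal ((u x)\<^sup>2) \<partial>lborel) \<le> 1 \<and>
     (\<forall>h. (\<integral>\<^sup>+x. ennreal ((u (x + h) - u x)\<^sup>2) \<partial>lborel) \<le> ennreal ((norm h)\<^sup>2))"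

text \<open>The weak L^q (Marcinkiewicz) condition; C bounds the q-th power of the
  quasinorm.\<close>

definition weak_Lq_bound :: "('a::euclidean_space \<Rightarrow> real) \<Rightarrow> real \<Rightarrow> real \<Rightarrow> bool" where
  "weak_Lq_bound u q C \<longleftrightarrow> (\<forall>s>0. emeasure lborel {x. \<bar>u x\<bar> > s} \<le> ennreal (C * s powr - q))"

text \<open>Chebyshev's inequality, the starting point of the bootstrap.\<close>

lemma weak_L2_bound:
  assumes "sobolev_unit u"
  shows "weak_Lq_bound u 2 1"
  unfolding weak_Lq_bound_def
proof (intro allI impI)
  fix s :: real assume s: "s > 0"
  have [measurable]: "u \<in> borel_measurable borel" and 1: "(\<integral>\<^sup>+x. ennreal ((u x)\<^sup>2) \<partial>lborel) \<le> 1"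
    using assms by (auto simp: sobolev_unit_def)
  have "emeasure lborel {x. \<bar>u x\<bar> > s} \<le> (\<integral>\<^sup>+x. ennreal (s powr - 2) * ennreal ((u x)\<^sup>2) \<partial>lborel)"
  proof (subst nn_integral_indicator[symmetric])
    show "(\<integral>\<^sup>+x. indicator {x. \<bar>u x\<bar> > s} x \<partial>lborel) \<le> (\<integral>\<^sup>+x. ennreal (s powr - 2) * ennreal ((u x)\<^sup>2) \<partial>lborel)"
    proof (intro nn_integral_mono)
      fix x
      have "1 \<le> s powr - 2 * (u x)\<^sup>2" if "\<bar>u x\<bar> > s"
      proof -
        have "s\<^sup>2 \<le> (u x)\<^sup>2" using that s by (simp add: abs_le_square_iff[symmetric])
        then show ?thesis using s by (simp add: powr_minus field_simps)
      qed
      then show "indicator {x. \<bar>u x\<bar> > s} x \<le> ennreal (s powr - 2) * ennreal ((u x)\<^sup>2)"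
        by (auto simp: indicator_def ennreal_mult[symmetric])
    qed
  qed measurable
  also have "\<dots> = ennreal (s powr - 2) * (\<integral>\<^sup>+x. ennreal ((u x)\<^sup>2) \<partial>lborel)"
    by (rule nn_integral_cmult) measurable
  also have "\<dots> \<le> ennreal (s powr - 2) * 1"
    using 1 by (rule mult_left_mono) simp
  finally show "emeasure lborel {x. \<bar>u x\<bar> > s} \<le> ennreal (1 * s powr - 2)" by simp
qed

text \<open>If \<open>\<bar>u x\<bar> > s\<close> and the ball \<open>B\<close> around \<open>0\<close> has twice the measure of \<open>{\<bar>u\<bar> > s / 2}\<close>, then
  \<open>\<bar>u (x + h) - u x\<bar> \<ge> s / 2\<close> for at least half of the \<open>h \<in> B\<close>.\<close>

lemma superlevel_set_bound:
  fixes u :: "'a::euclidean_space \<Rightarrow> real"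
  assumes u: "sobolev_unit u" and s: "s > 0" and t: "t > 0"
    and S: "emeasure lborel {x. \<bar>u x\<bar> > s / 2} \<le> ennreal (measure lborel (ball 0 t :: 'a set) / 2)"
  shows "emeasure lborel {x. \<bar>u x\<bar> > s} \<le> ennreal (8 * t\<^sup>2 / s\<^sup>2)"
proof -
  let ?B = "ball 0 t :: 'a set"
  let ?A = "{x. \<bar>u x\<bar> > s}"
  define b where "b = measure lborel ?B"
  have [measurable]: "u \<in> borel_measurable borel"
    and d: "\<And>h. (\<integral>\<^sup>+x. ennreal ((u (x + h) - u x)\<^sup>2) \<partial>lborel) \<le> ennreal ((norm h)\<^sup>2)"
    using u by (auto simp: sobolev_unit_def)
  have b: "b > 0" "emeasure lborel ?B = ennreal b"
    using t content_ball_pos[of t "0::'a"] emeasure_lborel_ball_finite[of "0::'a" t] by (auto simp: b_def less_top intro!: emeasure_eq_ennreal_measure)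
  \<comment> \<open>The constant is (s/2)^2 from the oscillation times b/2 for the half of the ball
    where it occurs. The exceptional h form a translate of the superlevel set at height s/2, so they
    have measure at most b/2.\<close>
  have half: "ennreal (s\<^sup>2 / 8 * b) \<le> (\<integral>\<^sup>+h. indicator ?B h * ennreal ((u (x + h) - u x)\<^sup>2) \<partial>lborel)"
    if x: "x \<in> ?A" for x
  proof -
    let ?T = "{h \<in> ?B. \<bar>u (x + h)\<bar> \<le> s / 2}"
    have "emeasure lborel ?B \<le> emeasure lborel (?T \<union> {h. \<bar>u (x + h)\<bar> > s / 2})"
      by (intro emeasure_mono) auto
    also have "\<dots> \<le> emeasure lborel ?T + emeasure lborel {h. \<bar>u (x + h)\<bar> > s / 2}"
      by (intro emeasure_subadditive) measurable
    also have "emeasure lborel {h. \<bar>u (x + h)\<bar> > s / 2} = emeasure lborel {h. \<bar>u h\<bar> > s / 2}"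
    proof -
      have "(\<integral>\<^sup>+h. indicator {h. \<bar>u h\<bar> > s / 2} (h + x) \<partial>lborel) = emeasure lborel {h. \<bar>u h\<bar> > s / 2}"
        by (subst lborel_shift) auto
      moreover have "(\<integral>\<^sup>+h. indicator {h. \<bar>u h\<bar> > s / 2} (h + x) \<partial>lborel) = (\<integral>\<^sup>+h. indicator {h. \<bar>u (x + h)\<bar> > s / 2} h \<partial>lborel)"
        by (intro nn_integral_cong) (auto simp: indicator_def add.commute)
      ultimately show ?thesis by simp
    qed
    also have "\<dots> \<le> ennreal (b / 2)" using S by (simp add: b_def)
    finally have "ennreal b \<le> emeasure lborel ?T + ennreal (b / 2)"
      using b by (simp add: add_left_mono)
    then have T: "ennreal (b / 2) \<le> emeasure lborel ?T"
    proof (cases "emeasure lborel ?T")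
      case (real r)
      then have "ennreal r + ennreal (b / 2) = ennreal (r + b / 2)"
        using b by (intro ennreal_plus[symmetric]) auto
      then have "ennreal b \<le> ennreal (r + b / 2)"
        using \<open>ennreal b \<le> _\<close> real by simp
      then have "b \<le> r + b / 2"
        using real b by (subst (asm) ennreal_le_iff) auto
      then show ?thesis using real by (simp add: ennreal_leI)
    qed simp
    have "ennreal (s\<^sup>2 / 8 * b) = ennreal (s\<^sup>2 / 4) * ennreal (b / 2)"
      using b by (simp add: ennreal_mult[symmetric])
    also have "\<dots> \<le> ennreal (s\<^sup>2 / 4) * emeasure lborel ?T"
      using T by (rule mult_left_mono) simp
    also have "\<dots> = (\<integral>\<^sup>+h. ennreal (s\<^sup>2 / 4) * indicator ?T h \<partial>lborel)"
      by (subst nn_integral_cmult_indicator) auto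
    also have "\<dots> \<le> (\<integral>\<^sup>+h. indicator ?B h * ennreal ((u (x + h) - u x)\<^sup>2) \<partial>lborel)"
    proof (intro nn_integral_mono)
      fix h
      have "s\<^sup>2 / 4 \<le> (u (x + h) - u x)\<^sup>2" if "\<bar>u (x + h)\<bar> \<le> s / 2"
      proof -
        have "\<bar>s / 2\<bar> \<le> \<bar>u (x + h) - u x\<bar>" using that x s by (auto simp: abs_if split: if_splits)
        then have "(s / 2)\<^sup>2 \<le> (u (x + h) - u x)\<^sup>2" by (simp only: abs_le_square_iff)
        then show ?thesis by (simp add: power_divide)
      qed
      then show "ennreal (s\<^sup>2 / 4) * indicator ?T h \<le> indicator ?B h * ennreal ((u (x + h) - u x)\<^sup>2)"
        by (auto simp: indicator_def ennreal_leI)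
    qed
    finally show ?thesis .
  qed
  \<comment> \<open>Integrating over the superlevel set and exchanging the integrals leaves, for
    each h in the ball, at most (norm h)^2 <= t^2. The volume b then cancels from both
    sides.\<close>
  have "ennreal (s\<^sup>2 / 8 * b) * emeasure lborel ?A = (\<integral>\<^sup>+x. ennreal (s\<^sup>2 / 8 * b) * indicator ?A x \<partial>lborel)"
    by (subst nn_integral_cmult_indicator) auto
  also have "\<dots> \<le> (\<integral>\<^sup>+x. \<integral>\<^sup>+h. indicator ?B h * ennreal ((u (x + h) - u x)\<^sup>2) \<partial>lborel \<partial>lborel)"
    using half by (intro nn_integral_mono) (auto simp: indicator_def)
  also have "\<dots> = (\<integral>\<^sup>+h. \<integral>\<^sup>+x. indicator ?B h * ennreal ((u (x + h) - u x)\<^sup>2) \<partial>lborel \<partial>lborel)"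
  proof (rule lborel_pair.Fubini')
    have 1: "(\<lambda>z. indicator ?B (fst z) :: ennreal) \<in> borel_measurable (lborel \<Otimes>\<^sub>M lborel)"
      by (rule measurable_compose[OF measurable_fst borel_measurable_indicator]) simp
    have 2: "(\<lambda>z. ennreal ((u (snd z + fst z) - u (snd z))\<^sup>2)) \<in> borel_measurable (lborel \<Otimes>\<^sub>M lborel)"
      by measurable
    show "(\<lambda>(h, x). indicator ?B h * ennreal ((u (x + h) - u x)\<^sup>2)) \<in> borel_measurable (lborel \<Otimes>\<^sub>M lborel)"
      using borel_measurable_times_ennreal[OF 1 2] by (simp add: case_prod_beta')
  qed
  also have "\<dots> \<le> (\<integral>\<^sup>+h. ennreal (t\<^sup>2) * indicator ?B h \<partial>lborel)"
  proof (intro nn_integral_mono)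
    fix h
    show "(\<integral>\<^sup>+x. indicator ?B h * ennreal ((u (x + h) - u x)\<^sup>2) \<partial>lborel) \<le> ennreal (t\<^sup>2) * indicator ?B h"
    proof (cases "h \<in> ?B")
      case True
      then have "(norm h)\<^sup>2 \<le> t\<^sup>2" by (intro power_mono) auto
      then show ?thesis using True order_trans[OF d[of h] ennreal_leI] by simp
    qed simp
  qed
  also have "\<dots> = ennreal (t\<^sup>2 * b)"
    using b by (subst nn_integral_cmult_indicator) (auto simp: ennreal_mult[symmetric])
  finally have *: "ennreal (s\<^sup>2 / 8 * b) * emeasure lborel ?A \<le> ennreal (t\<^sup>2 * b)" .
  show ?thesis
  proof (cases "emeasure lborel ?A")
    case (real r)
    then have "s\<^sup>2 / 8 * b * r \<le> t\<^sup>2 * b"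
      using * b by (simp add: ennreal_mult[symmetric] ennreal_le_iff)
    then have "s\<^sup>2 / 8 * r \<le> t\<^sup>2" using b by (simp add: mult.assoc mult.commute[of b] mult.left_commute[of b])
    then have "r \<le> 8 * t\<^sup>2 / s\<^sup>2" using s by (simp add: field_simps)
    then show ?thesis using real by (simp add: ennreal_leI)
  next
    case top
    moreover have "\<not> ennreal (s\<^sup>2 / 8 * b) \<le> 0" using s b by simp
    ultimately show ?thesis using * by (simp add: ennreal_mult_top top_unique)
  qed
qed

text \<open>The radius t of \<open>superlevel_set_bound\<close> is chosen so that the ball has
  exactly twice the measure C (s/2)^(-q) granted by the hypothesis. With N = \<open>DIM('a)\<close>
  this reads t^N = c, hence t^2 = K s^(-2q/N), and 8 t^2 / s^2 decays with the new exponent. The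
  constant depends neither on u nor on s.\<close>

lemma weak_Lq_bound_step:
  assumes "C > 0"
  obtains C' where "C' > 0"
    "\<And>u. sobolev_unit u \<Longrightarrow> weak_Lq_bound (u :: 'a::euclidean_space \<Rightarrow> real) q C \<Longrightarrow> weak_Lq_bound u (2 + 2 * q / DIM('a)) C'"
proof -
  define V where "V = unit_ball_vol (real DIM('a))"
  define K where "K = (2 * C * 2 powr q / V) powr (2 / DIM('a))"
  have V: "V > 0" by (simp add: V_def)
  show ?thesis
  proof
    show "8 * K > 0" using \<open>C > 0\<close> V by (simp add: K_def)
    fix u :: "'a \<Rightarrow> real" assume u: "sobolev_unit u" and w: "weak_Lq_bound u q C"
    show "weak_Lq_bound u (2 + 2 * q / DIM('a)) (8 * K)"
      unfolding weak_Lq_bound_def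
    proof (intro allI impI)
      fix s :: real assume s: "s > 0"
      define c where "c = 2 * C * 2 powr q / V * s powr - q"
      define t where "t = c powr (1 / DIM('a))"
      have c: "c > 0" using \<open>C > 0\<close> V s by (simp add: c_def)
      then have t: "t > 0" by (simp add: t_def)
      have "t ^ DIM('a) = c"
        using c by (simp add: t_def powr_realpow[symmetric] powr_powr)
      then have vol: "measure lborel (ball 0 t :: 'a set) / 2 = C * (s / 2) powr - q"
        using t V s by (simp add: content_ball V_def[symmetric] c_def powr_divide powr_minus field_simps)
      have "emeasure lborel {x. \<bar>u x\<bar> > s / 2} \<le> ennreal (C * (s / 2) powr - q)"
        using w s unfolding weak_Lq_bound_def by (meson half_gt_zero)
      then have "emeasure lborel {x. \<bar>u x\<bar> > s} \<le> ennreal (8 * t\<^sup>2 / s\<^sup>2)"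
        by (intro superlevel_set_bound u s t) (simp only: vol)
      also have "8 * t\<^sup>2 / s\<^sup>2 = 8 * K * s powr - (2 + 2 * q / DIM('a))"
      proof -
        have "t\<^sup>2 = c powr (2 / DIM('a))"
          using t c by (simp add: t_def powr_realpow[symmetric] powr_powr)
        also have "\<dots> = K * s powr (- (2 * q / DIM('a)))"
          unfolding c_def K_def by (subst powr_mult) (simp add: powr_powr mult.commute[of q])
        finally have "8 * t\<^sup>2 / s\<^sup>2 = 8 * K * (s powr (- (2 * q / DIM('a))) * s powr - 2)"
          using s by (simp add: powr_minus field_simps)
        also have "s powr (- (2 * q / DIM('a))) * s powr - 2 = s powr - (2 + 2 * q / DIM('a))"
          by (subst powr_add[symmetric]) (simp add: algebra_simps)
        finally show ?thesis .
      qed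
      finally show "emeasure lborel {x. \<bar>u x\<bar> > s} \<le> ennreal (8 * K * s powr - (2 + 2 * q / DIM('a)))" .
    qed
  qed
qed

text \<open>Finitely many bootstrap steps suffice for a strictly subcritical r, so a finite constant
  uniform in u survives even if the constants grow along the iteration.\<close>

lemma weak_Lq_bound_subcritical:
  fixes r :: real
  assumes N: "DIM('a::euclidean_space) \<ge> 3" and r: "r < 2 * real DIM('a) / (real DIM('a) - 2)"
  obtains q C where "q > r" "C > 0" "\<And>u :: 'a \<Rightarrow> real. sobolev_unit u \<Longrightarrow> weak_Lq_bound u q C"
proof -
  define \<theta> :: real where "\<theta> = 2 / DIM('a)"
  have \<theta>: "0 < \<theta>" "\<theta> < 1" using N by (auto simp: \<theta>_def)
  \<comment> \<open>The closed form of the iteration q -> 2 + \<theta> q started at q = 2: a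
    geometric sum with ratio \<theta> = 2/N < 1, whose limit 2 / (1 - \<theta>) is the critical
    exponent.\<close>
  define qs where "qs k = 2 * (\<Sum>j<Suc k. \<theta> ^ j)" for k
  have qs: "qs (Suc k) = 2 + 2 * qs k / DIM('a)" for k
    unfolding qs_def by (subst sum.lessThan_Suc_shift) (simp add: sum_distrib_left \<theta>_def mult_ac sum_divide_distrib add_divide_distrib)
  have *: "\<exists>C>0. \<forall>u :: 'a \<Rightarrow> real. sobolev_unit u \<longrightarrow> weak_Lq_bound u (qs k) C" for k
  proof (induction k)
    case 0
    then show ?case using weak_L2_bound by (intro exI[of _ 1]) (auto simp: qs_def)
  next
    case (Suc k)
    then obtain C where C: "C > 0" "\<And>u :: 'a \<Rightarrow> real. sobolev_unit u \<Longrightarrow> weak_Lq_bound u (qs k) C" by auto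
    from weak_Lq_bound_step[OF C(1), where 'a = 'a and q = "qs k"] obtain C' where
      "C' > 0" "\<And>u :: 'a \<Rightarrow> real. sobolev_unit u \<Longrightarrow> weak_Lq_bound u (qs k) C \<Longrightarrow> weak_Lq_bound u (qs (Suc k)) C'"
      unfolding qs by metis
    then show ?case using C by auto
  qed
  have "(\<lambda>k. \<Sum>j<k. \<theta> ^ j) \<longlonglongrightarrow> 1 / (1 - \<theta>)"
    using geometric_sums[of \<theta>] \<theta> by (simp add: sums_def)
  then have "qs \<longlonglongrightarrow> 2 * (1 / (1 - \<theta>))"
    unfolding qs_def by (intro tendsto_mult tendsto_const LIMSEQ_Suc)
  moreover have "2 * (1 / (1 - \<theta>)) = 2 * real DIM('a) / (real DIM('a) - 2)"
    using N by (simp add: \<theta>_def field_simps)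
  ultimately have "\<forall>\<^sub>F k in sequentially. r < qs k"
    using r by (auto elim: order_tendstoD)
  then obtain k where "r < qs k" by (auto dest: eventually_happens)
  then show ?thesis using *[of k] that by auto
qed

section \<open>From weak-type bounds to integrals\<close>

text \<open>The index k is that of the dyadic shell (2^k M, 2^(k+1) M] containing a.\<close>

lemma powr_tail_le_dyadic_sum:
  fixes a M r :: real
  assumes "M > 0" "r \<ge> 0" "a > M"
  shows "\<exists>k. 2 ^ k * M < a \<and> a powr r \<le> (2 ^ Suc k * M) powr r"
proof -
  obtain n where "a / M < 2 ^ n"
    using real_arch_pow[of 2 "a / M"] by auto
  then have ex: "\<exists>n. a \<le> 2 ^ n * M"
    using assms by (auto simp: field_simps intro!: exI[of _ n])
  define m where "m = (LEAST n. a \<le> 2 ^ n * M)"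
  have m: "a \<le> 2 ^ m * M" unfolding m_def using ex by (rule LeastI_ex)
  have "m \<noteq> 0"
  proof
    assume "m = 0"
    with m have "a \<le> M" by simp
    with \<open>a > M\<close> show False by simp
  qed
  then obtain k where k: "m = Suc k" by (cases m) auto
  then have "\<not> a \<le> 2 ^ k * M"
    unfolding m_def using not_less_Least[of k "\<lambda>n. a \<le> 2 ^ n * M"] by simp
  then show ?thesis
    using m k assms by (intro exI[of _ k] conjI powr_mono2) auto
qed

text \<open>On the k-th dyadic shell above M the integrand is at most (2^(k+1) M)^r and the measure
  at most C (2^k M)^(-q). The product is C 2^r M^(r-q) z^k with z = 2^(r-q), a geometric series
  because r < q; D is C 2^r times its sum.\<close>

lemma weak_Lq_bound_tail:
  fixes q r C :: real
  assumes "0 \<le> r" "r < q" "C > 0"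
  obtains D where "D > 0" "\<And>(u :: 'a::euclidean_space \<Rightarrow> real) M. u \<in> borel_measurable borel \<Longrightarrow> weak_Lq_bound u q C \<Longrightarrow> M > 0
     \<Longrightarrow> (\<integral>\<^sup>+x. ennreal (\<bar>u x\<bar> powr r) * indicator {x. \<bar>u x\<bar> > M} x \<partial>lborel) \<le> ennreal (D * M powr (r - q))"
proof -
  define z where "z = 2 powr (r - q)"
  have z: "0 < z" "z < 1" using assms by (auto simp: z_def powr_less_one)
  define D where "D = C * 2 powr r * (1 / (1 - z))"
  show ?thesis
  proof
    show "D > 0" using assms z by (simp add: D_def)
    fix u :: "'a \<Rightarrow> real" and M :: real
    assume [measurable]: "u \<in> borel_measurable borel" and w: "weak_Lq_bound u q C" and M: "M > 0"
    have "(\<integral>\<^sup>+x. ennreal (\<bar>u x\<bar> powr r) * indicator {x. \<bar>u x\<bar> > M} x \<partial>lborel)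
        \<le> (\<integral>\<^sup>+x. (\<Sum>k. ennreal ((2 ^ Suc k * M) powr r) * indicator {x. \<bar>u x\<bar> > 2 ^ k * M} x) \<partial>lborel)"
    proof (intro nn_integral_mono)
      fix x
      show "ennreal (\<bar>u x\<bar> powr r) * indicator {x. \<bar>u x\<bar> > M} x
          \<le> (\<Sum>k. ennreal ((2 ^ Suc k * M) powr r) * indicator {x. \<bar>u x\<bar> > 2 ^ k * M} x)"
      proof (cases "\<bar>u x\<bar> > M")
        case True
        then obtain k where k: "2 ^ k * M < \<bar>u x\<bar>" "\<bar>u x\<bar> powr r \<le> (2 ^ Suc k * M) powr r"
          using powr_tail_le_dyadic_sum[OF M \<open>0 \<le> r\<close> True] by auto
        have "ennreal (\<bar>u x\<bar> powr r) * indicator {x. \<bar>u x\<bar> > M} x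
            \<le> (\<Sum>k\<in>{k}. ennreal ((2 ^ Suc k * M) powr r) * indicator {x. \<bar>u x\<bar> > 2 ^ k * M} x)"
          using k True by (simp add: ennreal_leI)
        also have "\<dots> \<le> (\<Sum>k. ennreal ((2 ^ Suc k * M) powr r) * indicator {x. \<bar>u x\<bar> > 2 ^ k * M} x)"
          by (intro sum_le_suminf) auto
        finally show ?thesis .
      qed simp
    qed
    also have "\<dots> = (\<Sum>k. \<integral>\<^sup>+x. ennreal ((2 ^ Suc k * M) powr r) * indicator {x. \<bar>u x\<bar> > 2 ^ k * M} x \<partial>lborel)"
      by (rule nn_integral_suminf) measurable
    also have "\<dots> \<le> (\<Sum>k. ennreal (C * 2 powr r * M powr (r - q) * z ^ k))"
    proof (intro suminf_le)
      fix k
      have "(\<integral>\<^sup>+x. ennreal ((2 ^ Suc k * M) powr r) * indicator {x. \<bar>u x\<bar> > 2 ^ k * M} x \<partial>lborel)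
          = ennreal ((2 ^ Suc k * M) powr r) * emeasure lborel {x. \<bar>u x\<bar> > 2 ^ k * M}"
        by (rule nn_integral_cmult_indicator) measurable
      also have "\<dots> \<le> ennreal ((2 ^ Suc k * M) powr r) * ennreal (C * (2 ^ k * M) powr - q)"
        using w M by (intro mult_left_mono) (auto simp: weak_Lq_bound_def)
      also have "\<dots> = ennreal ((2 ^ Suc k * M) powr r * (C * (2 ^ k * M) powr - q))"
        using assms by (intro ennreal_mult[symmetric]) auto
      also have "(2 ^ Suc k * M) powr r * (C * (2 ^ k * M) powr - q) = C * 2 powr r * M powr (r - q) * z ^ k"
      proof -
        have "(2 ^ Suc k * M) powr r = 2 powr r * (2 ^ k * M) powr r"
          using M by (simp add: powr_mult)
        moreover have "(2 ^ k * M) powr r * (2 ^ k * M) powr - q = (2 ^ k * M) powr (r - q)"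
          by (simp add: powr_add[symmetric])
        moreover have "(2 ^ k * M) powr (r - q) = (2 ^ k) powr (r - q) * M powr (r - q)"
          using M by (simp add: powr_mult)
        moreover have "(2 ^ k) powr (r - q) = z ^ k"
          by (simp add: z_def powr_realpow[symmetric] powr_powr mult.commute)
        ultimately show ?thesis by (simp add: mult_ac)
      qed
      finally show "(\<integral>\<^sup>+x. ennreal ((2 ^ Suc k * M) powr r) * indicator {x. \<bar>u x\<bar> > 2 ^ k * M} x \<partial>lborel)
          \<le> ennreal (C * 2 powr r * M powr (r - q) * z ^ k)" .
    qed auto
    also have "\<dots> = ennreal (C * 2 powr r * M powr (r - q) * (1 / (1 - z)))"
    proof (rule suminf_ennreal_eq)
      show "0 \<le> C * 2 powr r * M powr (r - q) * z ^ k" for k using assms z by simp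
      show "(\<lambda>k. C * 2 powr r * M powr (r - q) * z ^ k) sums (C * 2 powr r * M powr (r - q) * (1 / (1 - z)))"
        using z by (intro sums_mult geometric_sums) auto
    qed
    also have "C * 2 powr r * M powr (r - q) * (1 / (1 - z)) = D * M powr (r - q)"
      by (simp add: D_def)
    finally show "(\<integral>\<^sup>+x. ennreal (\<bar>u x\<bar> powr r) * indicator {x. \<bar>u x\<bar> > M} x \<partial>lborel) \<le> ennreal (D * M powr (r - q))" .
  qed
qed

text \<open>A weak bound with exponent q > r controls the tail of |u|^r. Below height 1 the power is
  dominated by u^2 as r >= 2, which gives global integrability. For small balls the height M is
  fixed first so that the tail is below \<eta>/2 for all u at once, and then \<rho> so that M^r
  times the volume of the ball is below \<eta>/2.\<close>

lemma sobolev_unit_powr_integrals: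
  fixes r :: real
  assumes N: "DIM('a::euclidean_space) \<ge> 3" and r: "2 \<le> r" "r < 2 * real DIM('a) / (real DIM('a) - 2)"
  shows "sobolev_unit u \<Longrightarrow> (\<integral>\<^sup>+x. ennreal (\<bar>u x\<bar> powr r) \<partial>(lborel :: 'a measure)) < \<infinity>"
    and "\<eta> > 0 \<Longrightarrow> \<exists>\<rho>>0. \<forall>(u :: 'a \<Rightarrow> real) y. sobolev_unit u \<longrightarrow>
      (\<integral>\<^sup>+x. ennreal (\<bar>u x\<bar> powr r) * indicator (ball y \<rho>) x \<partial>lborel) \<le> ennreal \<eta>"
proof -
  obtain q C where q: "q > r" and C: "C > 0" and w: "\<And>u :: 'a \<Rightarrow> real. sobolev_unit u \<Longrightarrow> weak_Lq_bound u q C"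
    using weak_Lq_bound_subcritical[OF N r(2)] by metis
  obtain D where D: "D > 0" and tail: "\<And>(u :: 'a \<Rightarrow> real) M. sobolev_unit u \<Longrightarrow> M > 0
     \<Longrightarrow> (\<integral>\<^sup>+x. ennreal (\<bar>u x\<bar> powr r) * indicator {x. \<bar>u x\<bar> > M} x \<partial>lborel) \<le> ennreal (D * M powr (r - q))"
    using weak_Lq_bound_tail[of r q C] r q C w sobolev_unit_def by (smt (verit, ccfv_threshold))
  show "(\<integral>\<^sup>+x. ennreal (\<bar>u x\<bar> powr r) \<partial>(lborel :: 'a measure)) < \<infinity>" if u: "sobolev_unit u"
  proof -
    have [measurable]: "u \<in> borel_measurable borel" and 1: "(\<integral>\<^sup>+x. ennreal ((u x)\<^sup>2) \<partial>lborel) \<le> 1"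
      using u by (auto simp: sobolev_unit_def)
    have "(\<integral>\<^sup>+x. ennreal (\<bar>u x\<bar> powr r) \<partial>lborel)
        \<le> (\<integral>\<^sup>+x. ennreal ((u x)\<^sup>2) + ennreal (\<bar>u x\<bar> powr r) * indicator {x. \<bar>u x\<bar> > 1} x \<partial>lborel)"
    proof (intro nn_integral_mono)
      fix x
      have "\<bar>u x\<bar> powr r \<le> (u x)\<^sup>2" if "\<bar>u x\<bar> \<le> 1"
        using that r powr_mono'[of 2 r "\<bar>u x\<bar>"] by (cases "u x = 0") auto
      then show "ennreal (\<bar>u x\<bar> powr r) \<le> ennreal ((u x)\<^sup>2) + ennreal (\<bar>u x\<bar> powr r) * indicator {x. \<bar>u x\<bar> > 1} x"
        by (auto simp: indicator_def ennreal_leI)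
    qed
    also have "\<dots> = (\<integral>\<^sup>+x. ennreal ((u x)\<^sup>2) \<partial>lborel) + (\<integral>\<^sup>+x. ennreal (\<bar>u x\<bar> powr r) * indicator {x. \<bar>u x\<bar> > 1} x \<partial>lborel)"
      by (rule nn_integral_add) measurable
    also have "\<dots> \<le> 1 + ennreal (D * 1 powr (r - q))"
      by (intro add_mono 1 tail u) simp
    also have "\<dots> < \<infinity>" by (simp add: less_top)
    finally show ?thesis .
  qed
  show "\<exists>\<rho>>0. \<forall>(u :: 'a \<Rightarrow> real) y. sobolev_unit u \<longrightarrow>
      (\<integral>\<^sup>+x. ennreal (\<bar>u x\<bar> powr r) * indicator (ball y \<rho>) x \<partial>lborel) \<le> ennreal \<eta>" if \<eta>: "\<eta> > 0"
  proof -
    have "((\<lambda>M. D * M powr (r - q)) \<longlongrightarrow> D * 0) at_top"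
      using q by (intro tendsto_mult tendsto_const tendsto_neg_powr filterlim_ident) auto
    then have "\<forall>\<^sub>F M in at_top. D * M powr (r - q) < \<eta> / 2"
      using \<eta> by (intro order_tendstoD(2)[of _ "D * 0"]) auto
    then have "\<forall>\<^sub>F M in at_top. D * M powr (r - q) < \<eta> / 2 \<and> M > 0"
      using eventually_gt_at_top by (rule eventually_conj)
    then obtain M where M: "D * M powr (r - q) < \<eta> / 2" "M > 0"
      by (auto dest: eventually_happens)
    define V where "V = unit_ball_vol (real DIM('a))"
    have V: "V > 0" by (simp add: V_def)
    have "((\<lambda>\<rho>. M powr r * (V * \<rho> ^ DIM('a))) \<longlongrightarrow> M powr r * (V * 0 ^ DIM('a))) (at_right 0)"
      by (intro tendsto_intros)
    then have "\<forall>\<^sub>F \<rho> in at_right 0. M powr r * (V * \<rho> ^ DIM('a)) < \<eta> / 2"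
      using \<eta> by (intro order_tendstoD(2)[of _ "M powr r * (V * 0 ^ DIM('a))"]) (auto simp: power_0_left)
    then have "\<forall>\<^sub>F \<rho> in at_right 0. M powr r * (V * \<rho> ^ DIM('a)) < \<eta> / 2 \<and> \<rho> \<in> {0<..}"
      using eventually_at_right_less[of 0] by eventually_elim simp
    then obtain \<rho> where \<rho>: "M powr r * (V * \<rho> ^ DIM('a)) < \<eta> / 2" "\<rho> > 0"
      by (auto dest: eventually_happens)
    show ?thesis
    proof (intro exI[of _ \<rho>] conjI allI impI \<rho>(2))
      fix u :: "'a \<Rightarrow> real" and y assume u: "sobolev_unit u"
      then have [measurable]: "u \<in> borel_measurable borel" by (auto simp: sobolev_unit_def)
      have "(\<integral>\<^sup>+x. ennreal (\<bar>u x\<bar> powr r) * indicator (ball y \<rho>) x \<partial>lborel)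
         \<le> (\<integral>\<^sup>+x. ennreal (M powr r) * indicator (ball y \<rho>) x + ennreal (\<bar>u x\<bar> powr r) * indicator {x. \<bar>u x\<bar> > M} x \<partial>lborel)"
      proof (intro nn_integral_mono)
        fix x
        have "\<bar>u x\<bar> powr r \<le> M powr r" if "\<bar>u x\<bar> \<le> M"
          using that r by (intro powr_mono2) auto
        then show "ennreal (\<bar>u x\<bar> powr r) * indicator (ball y \<rho>) x
            \<le> ennreal (M powr r) * indicator (ball y \<rho>) x + ennreal (\<bar>u x\<bar> powr r) * indicator {x. \<bar>u x\<bar> > M} x"
          by (auto simp: indicator_def ennreal_leI)
      qed
      also have "\<dots> = (\<integral>\<^sup>+x. ennreal (M powr r) * indicator (ball y \<rho>) x \<partial>lborel)
           + (\<integral>\<^sup>+x. ennreal (\<bar>u x\<bar> powr r) * indicator {x. \<bar>u x\<bar> > M} x \<partial>lborel)"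
      proof (rule nn_integral_add)
        show "(\<lambda>x. ennreal (M powr r) * indicator (ball y \<rho>) x) \<in> borel_measurable lborel"
          by (intro borel_measurable_times_ennreal borel_measurable_indicator) auto
      qed measurable
      also have "\<dots> \<le> ennreal (\<eta> / 2) + ennreal (\<eta> / 2)"
      proof (rule add_mono)
        have "emeasure lborel (ball y \<rho>) = ennreal (V * \<rho> ^ DIM('a))"
          using \<rho>(2) by (simp add: emeasure_ball V_def)
        moreover have "0 \<le> V * \<rho> ^ DIM('a)" using \<rho>(2) V by simp
        ultimately have "(\<integral>\<^sup>+x. ennreal (M powr r) * indicator (ball y \<rho>) x \<partial>lborel) = ennreal (M powr r * (V * \<rho> ^ DIM('a)))"
          by (subst nn_integral_cmult_indicator) (simp_all add: ennreal_mult)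
        then show "(\<integral>\<^sup>+x. ennreal (M powr r) * indicator (ball y \<rho>) x \<partial>lborel) \<le> ennreal (\<eta> / 2)"
          using \<rho>(1) by (simp add: ennreal_leI)
        show "(\<integral>\<^sup>+x. ennreal (\<bar>u x\<bar> powr r) * indicator {x. \<bar>u x\<bar> > M} x \<partial>lborel) \<le> ennreal (\<eta> / 2)"
          using M(1) by (intro order_trans[OF tail[OF u M(2)]] ennreal_leI) simp
      qed
      also have "\<dots> = ennreal \<eta>"
        using \<eta> by (subst ennreal_plus[symmetric]) auto
      finally show "(\<integral>\<^sup>+x. ennreal (\<bar>u x\<bar> powr r) * indicator (ball y \<rho>) x \<partial>lborel) \<le> ennreal \<eta>" .
    qed
  qed
qed

section \<open>Transfer from Borel representatives to H^1\<close>

lemma locally_integrable_cong_AE: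
  assumes "locally_integrable f" and [measurable]: "g \<in> borel_measurable lebesgue" and "AE x in lebesgue. f x = g x"
  shows "locally_integrable (g :: 'a::euclidean_space \<Rightarrow> 'b::euclidean_space)"
  unfolding locally_integrable_def set_integrable_def
proof safe
  fix K :: "'a set" assume K: "compact K"
  then have [measurable]: "K \<in> sets lebesgue"
    by (simp add: borel_compact)
  have "integrable lebesgue (\<lambda>x. indicator K x *\<^sub>R f x)"
    using assms(1) K by (auto simp: locally_integrable_def set_integrable_def)
  then show "integrable lebesgue (\<lambda>x. indicator K x *\<^sub>R g x)"
    by (rule integrable_cong_AE_imp) (use assms(3) in \<open>auto intro!: borel_measurable_scaleR\<close>)
qed

lemma has_weak_gradient_cong_AE:
  fixes u :: "'a::euclidean_space \<Rightarrow> real"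
  assumes w: "has_weak_gradient u G"
    and m: "u' \<in> borel_measurable lebesgue" "G' \<in> borel_measurable lebesgue"
    and ae: "AE x in lebesgue. u x = u' x" "AE x in lebesgue. G x = G' x"
  shows "has_weak_gradient u' G'"
  unfolding has_weak_gradient_def
proof (intro conjI allI impI ballI)
  have l: "locally_integrable u" "locally_integrable G"
    using w by (auto simp: has_weak_gradient_def)
  show l': "locally_integrable u'" "locally_integrable G'"
    using l m ae by (blast intro: locally_integrable_cong_AE)+
  fix \<phi> :: "'a \<Rightarrow> real" and b :: 'a assume \<phi>: "test_function \<phi>" and b: "b \<in> Basis"
  have "(LINT x|lebesgue. u' x * frechet_derivative \<phi> (at x) b) = (LINT x|lebesgue. u x * frechet_derivative \<phi> (at x) b)"
    using ae integrable_mult_test_function(2)[OF l(1) \<phi> b] integrable_mult_test_function(2)[OF l'(1) \<phi> b]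
    by (intro integral_cong_AE) auto
  also have "\<dots> = - (LINT x|lebesgue. (G x \<bullet> b) * \<phi> x)"
    using w \<phi> b by (auto simp: has_weak_gradient_def)
  also have "(LINT x|lebesgue. (G x \<bullet> b) * \<phi> x) = (LINT x|lebesgue. (G' x \<bullet> b) * \<phi> x)"
    using ae integrable_mult_test_function(1)[OF locally_integrable_inner[OF l(2)] \<phi>]
      integrable_mult_test_function(1)[OF locally_integrable_inner[OF l'(2)] \<phi>]
    by (intro integral_cong_AE) auto
  finally show "(LINT x|lebesgue. u' x * frechet_derivative \<phi> (at x) b) = - (LINT x|lebesgue. (G' x \<bullet> b) * \<phi> x)" .
qed

lemma H1_integrable:
  assumes "u \<in> H1"
  shows "u \<in> borel_measurable lebesgue" "weak_gradient u \<in> borel_measurable lebesgue"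
    "integrable lebesgue (\<lambda>x. (u x)\<^sup>2)" "integrable lebesgue (\<lambda>x. (norm (weak_gradient u x))\<^sup>2)"
    "integrable lebesgue (energy_density u)"
  using H1_D[OF assms] by (auto simp: L2_def energy_density_def[abs_def])

lemma energy_density_nonneg: "0 \<le> energy_density u x"
  by (simp add: energy_density_def)

lemma H1_eq_0_if_energy_eq_0:
  assumes "u \<in> H1" "(LINT x|lebesgue. energy_density u x) = 0"
  shows "AE x in lebesgue. u x = 0"
proof -
  have "AE x in lebesgue. energy_density u x = 0"
    using assms H1_integrable(5) energy_density_nonneg
    by (subst integral_nonneg_eq_0_iff_AE[symmetric]) auto
  then show ?thesis
    by eventually_elim (simp add: energy_density_def sum_power2_eq_zero_iff)
qed

text \<open>Borel representatives of u and of its weak gradient still form a weak gradient pair, so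
  the translation estimate applies to them. Dividing by the square root of the energy works for both
  requirements of \<open>sobolev_unit\<close>, since the L^2 part and the gradient part are each at
  most the energy.\<close>

lemma H1_normalized:
  fixes u :: "'a::euclidean_space \<Rightarrow> real"
  assumes u: "u \<in> H1" and E: "(LINT x|lebesgue. energy_density u x) > 0" (is "?E > 0")
  obtains w where "sobolev_unit w" "AE x in lborel. u x = sqrt ?E * w x"
proof -
  note H = H1_integrable[OF u]
  obtain u0 where [measurable]: "u0 \<in> borel_measurable borel" and u0: "AE x in lborel. u x = u0 x"
    using lebesgue_ex_borel_measurable[OF H(1)] by metis
  obtain G0 where [measurable]: "G0 \<in> borel_measurable borel" and G0: "AE x in lborel. weak_gradient u x = G0 x"
    using lebesgue_ex_borel_measurable[OF H(2)] by metis
  have w: "has_weak_gradient u0 G0"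
    by (rule has_weak_gradient_cong_AE[OF H1_D(2)[OF u]])
      (use u0 G0 in \<open>auto intro: AE_completion measurable_completion\<close>)
  have int: "integrable lborel (\<lambda>x. (u0 x)\<^sup>2)" "integrable lborel (\<lambda>x. (norm (G0 x))\<^sup>2)"
  proof -
    have "integrable lebesgue (\<lambda>x. (u0 x)\<^sup>2)"
      by (rule integrable_cong_AE_imp[OF H(3)]) (use AE_completion[OF u0] in \<open>auto intro: measurable_completion\<close>)
    then show "integrable lborel (\<lambda>x. (u0 x)\<^sup>2)" by (simp add: integrable_completion)
    have "integrable lebesgue (\<lambda>x. (norm (G0 x))\<^sup>2)"
      by (rule integrable_cong_AE_imp[OF H(4)]) (use AE_completion[OF G0] in \<open>auto intro: measurable_completion\<close>)
    then show "integrable lborel (\<lambda>x. (norm (G0 x))\<^sup>2)" by (simp add: integrable_completion)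
  qed
  have Eeq: "?E = (LINT x|lborel. (norm (G0 x))\<^sup>2) + (LINT x|lborel. (u0 x)\<^sup>2)"
  proof -
    have "?E = (LINT x|lebesgue. (norm (G0 x))\<^sup>2 + (u0 x)\<^sup>2)"
    proof (rule integral_cong_AE)
      show "AE x in lebesgue. energy_density u x = (norm (G0 x))\<^sup>2 + (u0 x)\<^sup>2"
        using AE_completion[OF u0] AE_completion[OF G0] by eventually_elim (simp add: energy_density_def)
      show "energy_density u \<in> borel_measurable lebesgue" using H(5) by blast
    qed (auto intro: measurable_completion)
    then show ?thesis using int by (simp add: integral_completion)
  qed
  let ?w = "\<lambda>x. u0 x / sqrt ?E"
  show ?thesis
  proof
    show "AE x in lborel. u x = sqrt ?E * ?w x" using u0 E by auto
    have le: "LINT x|lborel. (u0 x)\<^sup>2 \<le> ?E" "(LINT x|lborel. (norm (G0 x))\<^sup>2) \<le> ?E"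
      by (auto simp: Eeq)
    have "(\<integral>\<^sup>+x. ennreal ((?w x)\<^sup>2) \<partial>lborel) = ennreal (1 / ?E) * (\<integral>\<^sup>+x. ennreal ((u0 x)\<^sup>2) \<partial>lborel)"
      using E by (subst nn_integral_cmult[symmetric]) (auto simp: power_divide ennreal_mult[symmetric])
    also have "\<dots> = ennreal (1 / ?E * (LINT x|lborel. (u0 x)\<^sup>2))"
      using int E by (subst nn_integral_eq_integral) (auto simp: ennreal_mult[symmetric])
    also have "\<dots> \<le> 1"
      using le(1) E by (simp add: ennreal_le_1)
    finally have 1: "(\<integral>\<^sup>+x. ennreal ((?w x)\<^sup>2) \<partial>lborel) \<le> 1" .
    have 2: "(\<integral>\<^sup>+x. ennreal ((?w (x + h) - ?w x)\<^sup>2) \<partial>lborel) \<le> ennreal ((norm h)\<^sup>2)" for h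
    proof -
      have "(\<integral>\<^sup>+x. ennreal ((?w (x + h) - ?w x)\<^sup>2) \<partial>lborel)
          = ennreal (1 / ?E) * (\<integral>\<^sup>+x. ennreal ((u0 (x + h) - u0 x)\<^sup>2) \<partial>lborel)"
        using E by (subst nn_integral_cmult[symmetric])
          (auto simp: power_divide ennreal_mult[symmetric] diff_divide_distrib[symmetric])
      also have "\<dots> \<le> ennreal (1 / ?E) * (ennreal ((norm h)\<^sup>2) * (\<integral>\<^sup>+x. ennreal ((norm (G0 x))\<^sup>2) \<partial>lborel))"
        by (intro mult_left_mono weak_gradient_translation w) auto
      also have "\<dots> = ennreal (1 / ?E * ((norm h)\<^sup>2 * (LINT x|lborel. (norm (G0 x))\<^sup>2)))"
        using int E by (subst nn_integral_eq_integral) (auto simp: ennreal_mult[symmetric])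
      also have "\<dots> \<le> ennreal ((norm h)\<^sup>2)"
        using le(2) E by (intro ennreal_leI) (simp add: divide_simps mult_left_mono)
      finally show ?thesis .
    qed
    show "sobolev_unit ?w"
      unfolding sobolev_unit_def using 1 2 by auto
  qed
qed

context
  fixes r :: real
  assumes N: "DIM('a::euclidean_space) \<ge> 3" and r: "2 \<le> r" "r < 2 * real DIM('a) / (real DIM('a) - 2)"
begin

lemma H1_integrable_powr:
  assumes u: "(u :: 'a \<Rightarrow> real) \<in> H1"
  shows "integrable lebesgue (\<lambda>x. \<bar>u x\<bar> powr r)"
proof (cases "(LINT x|lebesgue. energy_density u x) = 0")
  case True
  have "AE x in lebesgue. u x = 0" by (rule H1_eq_0_if_energy_eq_0[OF u True])
  then have ae: "AE x in lebesgue. 0 = \<bar>u x\<bar> powr r" by eventually_elim simp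
  have "integrable lebesgue (\<lambda>x::'a. 0::real)" by simp
  then show ?thesis
    by (rule integrable_cong_AE_imp) (use ae H1_integrable(1)[OF u] in auto)
next
  case False
  let ?E = "LINT x|lebesgue. energy_density u x"
  have E: "?E > 0"
    using False Bochner_Integration.integral_nonneg[of lebesgue "energy_density u"] energy_density_nonneg[of u] by fastforce
  obtain w where w: "sobolev_unit w" and ae: "AE x in lborel. u x = sqrt ?E * w x"
    by (rule H1_normalized[OF u E])
  have [measurable]: "w \<in> borel_measurable borel" using w by (simp add: sobolev_unit_def)
  have "integrable lborel (\<lambda>x. \<bar>w x\<bar> powr r)"
    using sobolev_unit_powr_integrals(1)[OF N r w] by (intro integrableI_bounded) auto
  then have "integrable lebesgue (\<lambda>x. sqrt ?E powr r * \<bar>w x\<bar> powr r)"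
    by (simp add: integrable_completion)
  then show ?thesis
    by (rule integrable_cong_AE_imp)
      (use AE_completion[OF ae] E H1_integrable(1)[OF u] in \<open>auto simp: abs_mult powr_mult\<close>)
qed

text \<open>Both sides are homogeneous of degree r in u, which reduces the claim to normalized
  functions; zero energy is separate because it cannot be normalized but forces u = 0 almost
  everywhere. What matters is that \<rho> depends neither on u nor on the centre y.\<close>

lemma H1_powr_ball_small:
  assumes \<eta>: "\<eta> > 0"
  obtains \<rho> where "\<rho> > 0" "\<And>(u :: 'a \<Rightarrow> real) y. u \<in> H1 \<Longrightarrow>
      (LINT x|lebesgue. indicator (ball y \<rho>) x * \<bar>u x\<bar> powr r) \<le> \<eta> * (LINT x|lebesgue. energy_density u x) powr (r / 2)"
proof -
  obtain \<rho> where \<rho>: "\<rho> > 0" "\<And>(u :: 'a \<Rightarrow> real) y. sobolev_unit u \<Longrightarrow>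
      (\<integral>\<^sup>+x. ennreal (\<bar>u x\<bar> powr r) * indicator (ball y \<rho>) x \<partial>lborel) \<le> ennreal \<eta>"
    using sobolev_unit_powr_integrals(2)[OF N r \<eta>] by metis
  show ?thesis
  proof
    show "\<rho> > 0" by fact
    fix u :: "'a \<Rightarrow> real" and y assume u: "u \<in> H1"
    let ?E = "LINT x|lebesgue. energy_density u x"
    have [measurable]: "u \<in> borel_measurable lebesgue" by (rule H1_integrable(1)[OF u])
    show "(LINT x|lebesgue. indicator (ball y \<rho>) x * \<bar>u x\<bar> powr r) \<le> \<eta> * ?E powr (r / 2)"
    proof (cases "?E = 0")
      case True
      have "AE x in lebesgue. u x = 0" by (rule H1_eq_0_if_energy_eq_0[OF u True])
      then have "(LINT x|lebesgue. indicator (ball y \<rho>) x * \<bar>u x\<bar> powr r) = 0"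
        by (intro integral_eq_zero_AE) auto
      then show ?thesis using True by simp
    next
      case False
      have E: "?E > 0"
        using False Bochner_Integration.integral_nonneg[of lebesgue "energy_density u"] energy_density_nonneg[of u] by fastforce
      obtain w where w: "sobolev_unit w" and ae: "AE x in lborel. u x = sqrt ?E * w x"
        by (rule H1_normalized[OF u E])
      have [measurable]: "w \<in> borel_measurable borel" using w by (simp add: sobolev_unit_def)
      have m1: "(\<lambda>x. \<bar>u x\<bar> powr r) \<in> borel_measurable lebesgue"
        and m2: "(\<lambda>x. \<bar>w x\<bar> powr r) \<in> borel_measurable lborel"
        by measurable
      have "(LINT x|lborel. \<bar>w x\<bar> powr r * indicator (ball y \<rho>) x) \<le> \<eta>"
        using \<rho>(2)[OF w, of y] \<eta>
        by (intro integral_real_bounded) (auto simp: ennreal_mult ennreal_indicator)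
      then have "sqrt ?E powr r * (LINT x|lborel. \<bar>w x\<bar> powr r * indicator (ball y \<rho>) x) \<le> sqrt ?E powr r * \<eta>"
        by (intro mult_left_mono) auto
      moreover have "sqrt ?E powr r = ?E powr (r / 2)"
        using E by (simp add: powr_half_sqrt[symmetric] powr_powr)
      moreover have "(LINT x|lebesgue. indicator (ball y \<rho>) x * \<bar>u x\<bar> powr r)
          = (LINT x|lebesgue. sqrt ?E powr r * (\<bar>w x\<bar> powr r * indicator (ball y \<rho>) x))"
      proof (rule integral_cong_AE)
        show "AE x in lebesgue. indicator (ball y \<rho>) x * \<bar>u x\<bar> powr r = sqrt ?E powr r * (\<bar>w x\<bar> powr r * indicator (ball y \<rho>) x)"
          using AE_completion[OF ae] by eventually_elim (use E in \<open>auto simp: abs_mult powr_mult\<close>)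
        show "(\<lambda>x. indicator (ball y \<rho>) x * \<bar>u x\<bar> powr r) \<in> borel_measurable lebesgue"
          by (intro borel_measurable_times borel_measurable_indicator m1) auto
        show "(\<lambda>x. sqrt ?E powr r * (\<bar>w x\<bar> powr r * indicator (ball y \<rho>) x)) \<in> borel_measurable lebesgue"
          by (rule measurable_completion) (intro borel_measurable_times borel_measurable_indicator borel_measurable_const m2, auto)
      qed
      moreover have "(LINT x|lebesgue. \<bar>w x\<bar> powr r * indicator (ball y \<rho>) x) = (LINT x|lborel. \<bar>w x\<bar> powr r * indicator (ball y \<rho>) x)"
        by (rule integral_completion) (intro borel_measurable_times borel_measurable_indicator m2, auto)
      ultimately show ?thesis
        by (simp add: mult.commute)
    qed
  qed
qed

end

section \<open>Cutoffs\<close>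

definition gradient :: "('a::euclidean_space \<Rightarrow> real) \<Rightarrow> 'a \<Rightarrow> 'a" where
  "gradient f x = (\<Sum>b\<in>Basis. frechet_derivative f (at x) b *\<^sub>R b)"

lemma gradient_inner_Basis: "b \<in> Basis \<Longrightarrow> gradient f x \<bullet> b = frechet_derivative f (at x) b"
  by (simp add: gradient_def inner_sum_left inner_Basis if_distrib cong: if_cong)

lemma continuous_on_gradient:
  assumes "\<And>k. Ck k f"
  shows "continuous_on UNIV (gradient f)"
  unfolding gradient_def[abs_def]
  using assms[of "Suc 0"] by (intro continuous_intros) auto

lemma gradient_eq_0_if_const:
  assumes "open S" "x \<in> S" "\<And>z. z \<in> S \<Longrightarrow> f z = c"
  shows "gradient f x = 0"
proof -
  have "((\<lambda>x. c) has_derivative (\<lambda>h. 0)) (at x)" by simp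
  then have "(f has_derivative (\<lambda>h. 0)) (at x)"
    by (rule has_derivative_transform_within_open[OF _ assms(1,2)]) (simp add: assms(3))
  then show ?thesis by (simp add: gradient_def frechet_derivative_at[symmetric])
qed

text \<open>The map \<open>t \<mapsto> exp_inv 0 (a - exp_inv 0 t)\<close> vanishes for large \<open>t\<close> and is constant for \<open>t \<le> 0\<close>.\<close>

lemma smooth_cutoff:
  fixes y :: "'a::euclidean_space"
  assumes "0 < r" "r < R"
  obtains \<zeta> :: "'a \<Rightarrow> real" and B where
    "\<And>k. Ck k \<zeta>" "\<And>x. 0 \<le> \<zeta> x" "\<And>x. \<zeta> x \<le> 1"
    "\<And>x. norm (x - y) \<le> r \<Longrightarrow> \<zeta> x = 0" "\<And>x. norm (x - y) \<ge> R \<Longrightarrow> \<zeta> x = 1"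
    "B > 0" "\<And>x. norm (gradient \<zeta> x) \<le> B * indicator (cball y R - ball y r) x"
proof -
  \<comment> \<open>The value of the inner profile
    \<open>exp_inv 0 (R\<^sup>2 - (norm (x - y))\<^sup>2)\<close> on the sphere of radius r. Inside
    that sphere the profile is at least a, so \<zeta> vanishes; beyond R the profile is 0, and the
    factor \<open>1 / exp_inv 0 a\<close> normalizes \<zeta> to 1.\<close>
  define a where "a = exp_inv 0 (R\<^sup>2 - r\<^sup>2)"
  define \<zeta> where "\<zeta> x = exp_inv 0 (a - exp_inv 0 (R\<^sup>2 - (norm (x - y))\<^sup>2)) * (1 / exp_inv 0 a)" for x
  have "r\<^sup>2 < R\<^sup>2" using assms by (intro power_strict_mono) auto
  then have "a > 0" by (simp add: a_def exp_inv_pos_iff)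
  then have a': "exp_inv 0 a > 0" by (simp add: exp_inv_pos_iff)
  have smooth: "Ck k \<zeta>" for k
    unfolding \<zeta>_def[abs_def]
    by (intro Ck_mult Ck_exp_inv Ck_diff Ck_norm_power2 Ck_const)
  have zero: "\<zeta> x = 0" if "norm (x - y) \<le> r" for x
  proof -
    have "(norm (x - y))\<^sup>2 \<le> r\<^sup>2" using that by (intro power_mono) auto
    then have "a \<le> exp_inv 0 (R\<^sup>2 - (norm (x - y))\<^sup>2)"
      unfolding a_def by (intro exp_inv_mono) simp
    then show ?thesis by (simp add: \<zeta>_def exp_inv_def)
  qed
  have one: "\<zeta> x = 1" if "norm (x - y) \<ge> R" for x
  proof -
    have "R\<^sup>2 \<le> (norm (x - y))\<^sup>2" using that assms by (intro power_mono) auto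
    then have "exp_inv 0 (R\<^sup>2 - (norm (x - y))\<^sup>2) = 0"
      by (simp add: exp_inv_def)
    then show ?thesis using a' by (simp add: \<zeta>_def)
  qed
  have "continuous_on UNIV (gradient \<zeta>)" by (rule continuous_on_gradient[OF smooth])
  then have "compact (gradient \<zeta> ` cball y R)"
    by (meson compact_cball compact_continuous_image continuous_on_subset subset_UNIV)
  then obtain B where B: "B > 0" "\<And>x. x \<in> cball y R \<Longrightarrow> norm (gradient \<zeta> x) \<le> B"
    by (metis bounded_pos compact_imp_bounded imageI)
  show ?thesis
  proof (rule that[OF smooth _ _ zero one B(1)])
    show "0 \<le> \<zeta> x" for x by (simp add: \<zeta>_def exp_inv_bounds)
    show "\<zeta> x \<le> 1" for x
    proof -
      have "exp_inv 0 (a - exp_inv 0 (R\<^sup>2 - (norm (x - y))\<^sup>2)) \<le> exp_inv 0 a"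
        by (intro exp_inv_mono) (simp add: exp_inv_bounds)
      then show ?thesis using a' by (simp add: \<zeta>_def)
    qed
    \<comment> \<open>Local constancy gives a zero gradient only on open sets, which is why the
      annulus keeps both bounding spheres.\<close>
    show "norm (gradient \<zeta> x) \<le> B * indicator (cball y R - ball y r) x" for x
    proof -
      consider "x \<in> ball y r" | "x \<in> - cball y R" | "x \<in> cball y R - ball y r" by auto
      then show ?thesis
      proof cases
        case 1
        then have "gradient \<zeta> x = 0"
          by (intro gradient_eq_0_if_const[OF open_ball 1]) (auto simp: dist_norm norm_minus_commute intro!: zero)
        then show ?thesis using B(1) by simp
      next
        case 2
        then have "gradient \<zeta> x = 0"
          by (intro gradient_eq_0_if_const[of "- cball y R" x \<zeta> 1]) (auto simp: dist_norm norm_minus_commute intro!: one)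
        then show ?thesis using B(1) by simp
      qed (use B in auto)
    qed
  qed
qed

lemma locally_integrable_bound:
  fixes f :: "'a::euclidean_space \<Rightarrow> 'b::euclidean_space" and g :: "'a \<Rightarrow> 'c::euclidean_space"
  assumes "locally_integrable f" and [measurable]: "g \<in> borel_measurable lebesgue"
    and "\<And>x. norm (g x) \<le> B * norm (f x)"
  shows "locally_integrable g"
  unfolding locally_integrable_def set_integrable_def
proof safe
  fix K :: "'a set" assume K: "compact K"
  then have [measurable]: "K \<in> sets lebesgue" by (simp add: borel_compact)
  have "integrable lebesgue (\<lambda>x. B * norm (indicator K x *\<^sub>R f x))"
    using assms(1) K by (auto simp: locally_integrable_def set_integrable_def simp del: norm_scaleR)
  then show "integrable lebesgue (\<lambda>x. indicator K x *\<^sub>R g x)"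
    by (rule Bochner_Integration.integrable_bound)
      (use assms(3) order_trans[OF assms(3) abs_ge_self] in \<open>auto simp: indicator_def intro!: borel_measurable_scaleR borel_measurable_indicator\<close>)
qed

text \<open>Product rule: for a test function \<phi> the product of \<zeta> and \<phi> is again a
  test function, even if \<zeta> has unbounded support, and its Leibniz expansion is inserted into
  the definition of the weak gradient of u. The bound B keeps u times the gradient of \<zeta> square
  integrable. The formula holds only almost everywhere because \<open>weak_gradient\<close> is a
  choice.\<close>

lemma
  fixes \<zeta> u :: "'a::euclidean_space \<Rightarrow> real"
  assumes u: "u \<in> H1" and smooth: "\<And>k. Ck k \<zeta>" and \<zeta>: "\<And>x. 0 \<le> \<zeta> x" "\<And>x. \<zeta> x \<le> 1"
    and B: "\<And>x. norm (gradient \<zeta> x) \<le> B"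
  shows mult_in_H1: "(\<lambda>x. \<zeta> x * u x) \<in> H1"
    and weak_gradient_mult: "AE x in lebesgue. weak_gradient (\<lambda>x. \<zeta> x * u x) x
      = \<zeta> x *\<^sub>R weak_gradient u x + u x *\<^sub>R gradient \<zeta> x"
proof -
  let ?G = "weak_gradient u"
  let ?H = "\<lambda>x. \<zeta> x *\<^sub>R ?G x + u x *\<^sub>R gradient \<zeta> x"
  note H = H1_integrable[OF u]
  note [measurable] = H(1,2)
  have [measurable]: "\<zeta> \<in> borel_measurable lebesgue" "gradient \<zeta> \<in> borel_measurable lebesgue"
    using smooth[of 0] continuous_on_gradient[OF smooth]
    by (auto intro!: measurable_completion borel_measurable_continuous_onI)
  have w: "has_weak_gradient u ?G" by (rule H1_D(2)[OF u])
  then have lu: "locally_integrable u" and lG: "locally_integrable ?G"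
    by (auto simp: has_weak_gradient_def)
  have l1: "locally_integrable (\<lambda>x. \<zeta> x *\<^sub>R ?G x)"
    by (rule locally_integrable_bound[OF lG, where B = 1]) (use \<zeta> in \<open>auto intro!: mult_left_le_one_le\<close>)
  have l2: "locally_integrable (\<lambda>x. u x *\<^sub>R gradient \<zeta> x)"
    by (rule locally_integrable_bound[OF lu, where B = B])
      (use B in \<open>auto intro!: mult_right_mono simp: mult.commute[of "\<bar>_\<bar>"]\<close>)
  have lH: "locally_integrable ?H"
    using l1 l2 by (auto simp: locally_integrable_def intro!: set_integral_add)
  have l\<zeta>u: "locally_integrable (\<lambda>x. \<zeta> x * u x)"
    by (rule locally_integrable_bound[OF lu, where B = 1]) (use \<zeta> in \<open>auto simp: abs_mult intro!: mult_left_le_one_le\<close>)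
  have wH: "has_weak_gradient (\<lambda>x. \<zeta> x * u x) ?H"
    unfolding has_weak_gradient_def
  proof (intro conjI allI impI ballI l\<zeta>u lH)
    fix \<phi> :: "'a \<Rightarrow> real" and b :: 'a assume \<phi>: "test_function \<phi>" and b: "b \<in> Basis"
    have t: "test_function (\<lambda>x. \<zeta> x * \<phi> x)"
      by (rule test_function_mult[OF \<phi> smooth])
    have D: "frechet_derivative (\<lambda>x. \<zeta> x * \<phi> x) (at x) b
        = \<zeta> x * frechet_derivative \<phi> (at x) b + (gradient \<zeta> x \<bullet> b) * \<phi> x" for x
    proof -
      have "(\<zeta> has_derivative frechet_derivative \<zeta> (at x)) (at x)"
        using smooth[of "Suc 0"] by (simp add: frechet_derivative_works)
      from has_derivative_mult[OF this test_functionD(1)[OF \<phi>]]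
      show ?thesis
        using b by (simp add: frechet_derivative_at[symmetric] gradient_inner_Basis)
    qed
    have i1: "integrable lebesgue (\<lambda>x. \<zeta> x * u x * frechet_derivative \<phi> (at x) b)"
      by (rule integrable_mult_test_function(2)[OF l\<zeta>u \<phi> b])
    have i2: "integrable lebesgue (\<lambda>x. (u x *\<^sub>R gradient \<zeta> x) \<bullet> b * \<phi> x)"
      by (rule integrable_mult_test_function(1)[OF locally_integrable_inner[OF l2] \<phi>])
    have i3: "integrable lebesgue (\<lambda>x. (\<zeta> x *\<^sub>R ?G x) \<bullet> b * \<phi> x)"
      by (rule integrable_mult_test_function(1)[OF locally_integrable_inner[OF l1] \<phi>])
    have "(LINT x|lebesgue. \<zeta> x * u x * frechet_derivative \<phi> (at x) b) + (LINT x|lebesgue. (u x *\<^sub>R gradient \<zeta> x) \<bullet> b * \<phi> x)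
        = (LINT x|lebesgue. u x * frechet_derivative (\<lambda>x. \<zeta> x * \<phi> x) (at x) b)"
      unfolding D using Bochner_Integration.integral_add[OF i1 i2, symmetric] by (simp add: algebra_simps)
    also have "\<dots> = - (LINT x|lebesgue. (?G x \<bullet> b) * (\<zeta> x * \<phi> x))"
      using w t b by (auto simp: has_weak_gradient_def)
    finally have "(LINT x|lebesgue. \<zeta> x * u x * frechet_derivative \<phi> (at x) b)
       = - ((LINT x|lebesgue. (\<zeta> x *\<^sub>R ?G x) \<bullet> b * \<phi> x) + (LINT x|lebesgue. (u x *\<^sub>R gradient \<zeta> x) \<bullet> b * \<phi> x))"
      by (simp add: algebra_simps)
    then show "(LINT x|lebesgue. \<zeta> x * u x * frechet_derivative \<phi> (at x) b) = - (LINT x|lebesgue. (?H x \<bullet> b) * \<phi> x)"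
      using Bochner_Integration.integral_add[OF i3 i2, symmetric] by (simp add: inner_add_left distrib_right)
  qed
  have "integrable lebesgue (\<lambda>x. (\<zeta> x * u x)\<^sup>2)"
  proof (rule Bochner_Integration.integrable_bound[OF H(3)])
    have "(\<zeta> x * u x)\<^sup>2 \<le> (u x)\<^sup>2" for x
      using \<zeta>[of x] by (simp add: power_mult_distrib mult_left_le_one_le power_le_one)
    then show "AE x in lebesgue. norm ((\<zeta> x * u x)\<^sup>2) \<le> norm ((u x)\<^sup>2)" by simp
  qed measurable
  then have L2u: "(\<lambda>x. \<zeta> x * u x) \<in> L2"
    by (simp add: L2_def)
  have "integrable lebesgue (\<lambda>x. (norm (?H x))\<^sup>2)"
  proof (rule Bochner_Integration.integrable_bound)
    show "integrable lebesgue (\<lambda>x. 2 * (norm (?G x))\<^sup>2 + 2 * (B\<^sup>2 * (u x)\<^sup>2))"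
      using H(3,4) by auto
    have "(norm (?H x))\<^sup>2 \<le> 2 * (norm (?G x))\<^sup>2 + 2 * (B\<^sup>2 * (u x)\<^sup>2)" for x
    proof -
      have 1: "norm (\<zeta> x *\<^sub>R ?G x) \<le> norm (?G x)"
        using \<zeta>[of x] by (simp add: mult_left_le_one_le)
      have 2: "norm (u x *\<^sub>R gradient \<zeta> x) \<le> B * \<bar>u x\<bar>"
        using B[of x] by (simp add: mult.commute[of "\<bar>_\<bar>"] mult_right_mono)
      have "norm (?H x) \<le> norm (?G x) + B * \<bar>u x\<bar>"
        using norm_triangle_mono[OF 1 2] .
      then have "(norm (?H x))\<^sup>2 \<le> (norm (?G x) + B * \<bar>u x\<bar>)\<^sup>2"
        by (intro power_mono) auto
      also have "\<dots> \<le> 2 * (norm (?G x))\<^sup>2 + 2 * (B * \<bar>u x\<bar>)\<^sup>2"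
        using zero_le_power2[of "norm (?G x) - B * \<bar>u x\<bar>"] unfolding power2_diff power2_sum by linarith
      finally show ?thesis by (simp add: power_mult_distrib)
    qed
    then show "AE x in lebesgue. norm ((norm (?H x))\<^sup>2) \<le> norm (2 * (norm (?G x))\<^sup>2 + 2 * (B\<^sup>2 * (u x)\<^sup>2))"
      by simp
  qed measurable
  then have "?H \<in> L2" by (simp add: L2_def)
  then show "(\<lambda>x. \<zeta> x * u x) \<in> H1"
    using L2u wH by (auto simp: H1_def)
  show "AE x in lebesgue. weak_gradient (\<lambda>x. \<zeta> x * u x) x = ?H x"
    by (rule has_weak_gradient_unique[OF has_weak_gradient_weak_gradient[OF wH] wH])
qed

section \<open>Estimates for solutions\<close>

lemma Q_eq_indicator: "Q \<epsilon> (x - y) = 2 * indicator (ball y \<epsilon>) x - 1"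
  by (simp add: Q_def dist_norm norm_minus_commute)

lemma powr_double: "\<bar>t :: real\<bar> powr (2 * p) = (\<bar>t\<bar> powr p)\<^sup>2"
  by (simp add: power2_eq_square powr_add[symmetric])

text \<open>True at t = 0 as well, because \<open>0 powr q = 0\<close> for every q; this matches the
  convention for the nonlinearity when q < 2.\<close>

lemma powr_diff_2_mult: "\<bar>t :: real\<bar> powr (q - 2) * t * t = \<bar>t\<bar> powr q"
proof (cases "t = 0")
  case False
  then have "t * t = \<bar>t\<bar> powr 2" by (simp add: power2_eq_square)
  then show ?thesis by (simp only: mult.assoc powr_add[symmetric]) simp
qed simp

lemma energy_density_eq:
  "energy_density u x = weak_gradient u x \<bullet> weak_gradient u x + u x * u x"
  unfolding energy_density_def power2_norm_eq_inner by (simp add: power2_eq_square)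

lemma nonlinearity_mult_self:
  "nonlinearity l p y \<mu> \<Lambda> \<epsilon> v i x * v i x = \<mu> i * (2 * indicator (ball (y i) \<epsilon>) x - 1) * \<bar>v i x\<bar> powr (2 * p)
     + (\<Sum>j\<in>{1..l} - {i}. \<Lambda> i j * (\<bar>v j x\<bar> powr p * \<bar>v i x\<bar> powr p))"
proof -
  have 1: "\<mu> i * q * \<bar>t\<bar> powr (2 * p - 2) * t * t = \<mu> i * q * \<bar>t\<bar> powr (2 * p)" for q t :: real
    using powr_diff_2_mult[of t "2 * p"] by (simp add: mult.assoc)
  have 2: "a * b * (\<bar>t\<bar> powr (p - 2) * t) * t = a * (b * \<bar>t\<bar> powr p)" for a b t :: real
    using powr_diff_2_mult[of t p] by (simp add: mult.assoc)
  show ?thesis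
    unfolding nonlinearity_def Q_eq_indicator distrib_right sum_distrib_right 1 2 ..
qed

lemma mult_le_sum_squares: "a * b \<le> a\<^sup>2 + b\<^sup>2" for a b :: real
proof -
  have "(a - b / 2)\<^sup>2 = a\<^sup>2 - a * b + b\<^sup>2 / 4" by (simp add: power2_diff power_divide)
  then show ?thesis using zero_le_power2[of "a - b / 2"] zero_le_power2[of b] by linarith
qed

lemma integrable_cutoff_mult:
  fixes \<zeta> f :: "'a::euclidean_space \<Rightarrow> real"
  assumes "continuous_on UNIV \<zeta>" "\<And>x. 0 \<le> \<zeta> x" "\<And>x. \<zeta> x \<le> 1" and f: "integrable lebesgue f"
  shows "integrable lebesgue (\<lambda>x. \<zeta> x * f x)"
proof (rule Bochner_Integration.integrable_bound[OF f])
  have "\<zeta> \<in> borel_measurable lebesgue"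
    using assms(1) by (intro measurable_completion) (auto intro: borel_measurable_continuous_onI)
  then show "(\<lambda>x. \<zeta> x * f x) \<in> borel_measurable lebesgue"
    using f by (intro borel_measurable_times) auto
  show "AE x in lebesgue. norm (\<zeta> x * f x) \<le> norm (f x)"
    using assms(2,3) by (auto simp: abs_mult intro!: mult_left_le_one_le)
qed

text \<open>One solution at one value of \<epsilon> and one component of it. Keeping the sequence
  out makes it visible in each estimate which constants are independent of \<epsilon> and of
  v.\<close>

locale component =
  fixes l :: nat and p :: real and y :: "nat \<Rightarrow> 'a::euclidean_space"
    and \<mu> :: "nat \<Rightarrow> real" and \<Lambda> :: "nat \<Rightarrow> nat \<Rightarrow> real" and \<epsilon> :: real
    and v :: "nat \<Rightarrow> 'a \<Rightarrow> real" and i :: nat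
  assumes N: "DIM('a) \<ge> 3" and p: "1 < p" "p < real DIM('a) / (real DIM('a) - 2)"
    and i: "i \<in> {1..l}" and \<mu>: "\<mu> i > 0" and \<Lambda>: "\<And>j. j \<in> {1..l} \<Longrightarrow> i \<noteq> j \<Longrightarrow> \<Lambda> i j < 0"
    and sol: "weak_solution l p y \<mu> \<Lambda> \<epsilon> v"
begin

abbreviation "energy \<equiv> LINT x|lebesgue. energy_density (v i) x"

lemma H1: "j \<in> {1..l} \<Longrightarrow> v j \<in> H1"
  using sol by (auto simp: weak_solution_def)

lemma integrable_powr: "j \<in> {1..l} \<Longrightarrow> integrable lebesgue (\<lambda>x. \<bar>v j x\<bar> powr (2 * p))"
  using N p by (intro H1_integrable_powr H1) (auto simp: field_simps)

lemma energy_pos: "energy > 0"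
proof -
  have "energy \<noteq> 0"
    using H1_eq_0_if_energy_eq_0[OF H1[OF i]] sol i by (auto simp: weak_solution_def)
  moreover have "energy \<ge> 0"
    by (intro Bochner_Integration.integral_nonneg energy_density_nonneg)
  ultimately show ?thesis by simp
qed

text \<open>Needed before the equation can be estimated pointwise under the integral. The coupling
  terms are dominated by |v_j|^(2p) + |v_i|^(2p), which are integrable since 2p is
  subcritical.\<close>

lemma integrable_nonlinearity_mult_self:
  "integrable lebesgue (\<lambda>x. nonlinearity l p y \<mu> \<Lambda> \<epsilon> v i x * v i x)"
  unfolding nonlinearity_mult_self
proof (intro Bochner_Integration.integrable_add Bochner_Integration.integrable_sum integrable_mult_right)
  have "integrable lebesgue (\<lambda>x. indicator (ball (y i) \<epsilon>) x *\<^sub>R (\<bar>v i x\<bar> powr (2 * p)))"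
    by (intro integrable_mult_indicator integrable_powr i) auto
  then have "integrable lebesgue (\<lambda>x. \<mu> i * (2 * (indicator (ball (y i) \<epsilon>) x *\<^sub>R (\<bar>v i x\<bar> powr (2 * p))) - \<bar>v i x\<bar> powr (2 * p)))"
    using integrable_powr[OF i] by (intro integrable_mult_right Bochner_Integration.integrable_diff)
  then show "integrable lebesgue (\<lambda>x. \<mu> i * (2 * indicator (ball (y i) \<epsilon>) x - 1) * \<bar>v i x\<bar> powr (2 * p))"
    by (simp add: algebra_simps)
  fix j assume "j \<in> {1..l} - {i}"
  then have j: "j \<in> {1..l}" by simp
  have [measurable]: "v i \<in> borel_measurable lebesgue" "v j \<in> borel_measurable lebesgue"
    using H1_integrable(1)[OF H1] i j by auto
  show "integrable lebesgue (\<lambda>x. \<bar>v j x\<bar> powr p * \<bar>v i x\<bar> powr p)"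
  proof (rule Bochner_Integration.integrable_bound)
    show "integrable lebesgue (\<lambda>x. \<bar>v j x\<bar> powr (2 * p) + \<bar>v i x\<bar> powr (2 * p))"
      using integrable_powr i j by auto
    show "AE x in lebesgue. norm (\<bar>v j x\<bar> powr p * \<bar>v i x\<bar> powr p) \<le> norm (\<bar>v j x\<bar> powr (2 * p) + \<bar>v i x\<bar> powr (2 * p))"
      by (simp add: powr_double mult_le_sum_squares)
  qed measurable
qed

lemma nonlinearity_mult_self_le:
  "nonlinearity l p y \<mu> \<Lambda> \<epsilon> v i x * v i x \<le> \<mu> i * (2 * indicator (ball (y i) \<epsilon>) x - 1) * \<bar>v i x\<bar> powr (2 * p)"
proof -
  have "(\<Sum>j\<in>{1..l} - {i}. \<Lambda> i j * (\<bar>v j x\<bar> powr p * \<bar>v i x\<bar> powr p)) \<le> 0"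
    using \<Lambda> by (intro sum_nonpos mult_nonpos_nonneg) (auto simp: less_imp_le)
  then show ?thesis unfolding nonlinearity_mult_self by simp
qed

lemma energy_le_ball:
  "energy \<le> \<mu> i * (LINT x|lebesgue. indicator (ball (y i) \<epsilon>) x * \<bar>v i x\<bar> powr (2 * p))"
proof -
  have "energy = (LINT x|lebesgue. nonlinearity l p y \<mu> \<Lambda> \<epsilon> v i x * v i x)"
    using sol i H1[OF i] by (simp add: weak_solution_def energy_density_eq)
  also have "\<dots> \<le> (LINT x|lebesgue. \<mu> i * (indicator (ball (y i) \<epsilon>) x *\<^sub>R (\<bar>v i x\<bar> powr (2 * p))))"
  proof (rule integral_mono[OF integrable_nonlinearity_mult_self])
    show "integrable lebesgue (\<lambda>x. \<mu> i * (indicator (ball (y i) \<epsilon>) x *\<^sub>R (\<bar>v i x\<bar> powr (2 * p))))"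
      by (intro integrable_mult_right integrable_mult_indicator integrable_powr i) auto
    show "nonlinearity l p y \<mu> \<Lambda> \<epsilon> v i x * v i x \<le> \<mu> i * (indicator (ball (y i) \<epsilon>) x *\<^sub>R (\<bar>v i x\<bar> powr (2 * p)))" for x
      by (rule order_trans[OF nonlinearity_mult_self_le]) (use \<mu> in \<open>auto simp: indicator_def\<close>)
  qed
  finally show ?thesis by simp
qed

text \<open>Makes the full L^(2p) integral at least of the order of the energy, so an exterior part
  that is o(E) is negligible in the second ratio too.\<close>

lemma energy_le_powr: "energy \<le> \<mu> i * (LINT x|lebesgue. \<bar>v i x\<bar> powr (2 * p))"
proof -
  have "(LINT x|lebesgue. indicator (ball (y i) \<epsilon>) x *\<^sub>R \<bar>v i x\<bar> powr (2 * p)) \<le> (LINT x|lebesgue. \<bar>v i x\<bar> powr (2 * p))"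
    by (intro integral_mono integrable_mult_indicator integrable_powr i) (auto simp: indicator_def)
  then show ?thesis
    using energy_le_ball mult_left_mono[OF _ less_imp_le[OF \<mu>]] by fastforce
qed

text \<open>Dividing E <= \<mu> \<eta> E^p by E^p. As p > 1, a small left-hand side means large
  energy.\<close>

lemma energy_powr_small:
  assumes "\<epsilon> \<le> \<rho>" and \<rho>: "(LINT x|lebesgue. indicator (ball (y i) \<rho>) x * \<bar>v i x\<bar> powr (2 * p)) \<le> \<eta> * energy powr p"
  shows "energy powr (1 - p) \<le> \<mu> i * \<eta>"
proof -
  have "(LINT x|lebesgue. indicator (ball (y i) \<epsilon>) x *\<^sub>R \<bar>v i x\<bar> powr (2 * p))
      \<le> (LINT x|lebesgue. indicator (ball (y i) \<rho>) x *\<^sub>R \<bar>v i x\<bar> powr (2 * p))"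
    by (intro integral_mono integrable_mult_indicator integrable_powr i)
      (use \<open>\<epsilon> \<le> \<rho>\<close> in \<open>auto simp: indicator_def\<close>)
  also have "\<dots> \<le> \<eta> * energy powr p" using \<rho> by simp
  finally have "energy \<le> \<mu> i * (\<eta> * energy powr p)"
    using energy_le_ball mult_left_mono[OF _ less_imp_le[OF \<mu>]] by fastforce
  then have "energy * energy powr - p \<le> \<mu> i * (\<eta> * energy powr p) * energy powr - p"
    by (rule mult_right_mono) simp
  also have "\<dots> = \<mu> i * \<eta>" using energy_pos by (simp add: powr_minus)
  also have "energy * energy powr - p = energy powr (1 - p)"
    using energy_pos by (simp add: powr_diff powr_minus field_simps)
  finally show ?thesis .
qed

context
  fixes \<zeta> :: "'a \<Rightarrow> real" and B r R :: real
  assumes smooth: "\<And>k. Ck k \<zeta>" and \<zeta>: "\<And>x. 0 \<le> \<zeta> x" "\<And>x. \<zeta> x \<le> 1" "\<And>x. norm (x - y i) \<le> r \<Longrightarrow> \<zeta> x = 0"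
    and B: "B > 0" "\<And>x. norm (gradient \<zeta> x) \<le> B * indicator (cball (y i) R - ball (y i) r) x"
    and r: "\<epsilon> \<le> r"
begin

text \<open>With \<epsilon> <= r the cutoff sees only the region where Q = -1, so the tested
  right-hand side has a sign and its self-interaction can be moved to the left. What remains is the
  product-rule term w (grad w . grad \<zeta>), supported in the annulus.\<close>

lemma cutoff_estimate:
  shows "integrable lebesgue (\<lambda>x. indicator (cball (y i) R - ball (y i) r) x * (\<bar>v i x\<bar> * norm (weak_gradient (v i) x)))" (is "integrable _ ?A")
    and "(LINT x|lebesgue. \<zeta> x * (energy_density (v i) x + \<mu> i * \<bar>v i x\<bar> powr (2 * p)))
     \<le> B * (LINT x|lebesgue. indicator (cball (y i) R - ball (y i) r) x * (\<bar>v i x\<bar> * norm (weak_gradient (v i) x)))"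
proof -
  let ?w = "v i" and ?G = "weak_gradient (v i)" and ?g = "gradient \<zeta>"
  have w: "?w \<in> H1" by (rule H1[OF i])
  note H = H1_integrable[OF w]
  note [measurable] = H(1,2)
  have [measurable]: "?g \<in> borel_measurable lebesgue"
    using continuous_on_gradient[OF smooth] by (intro measurable_completion) (auto intro: borel_measurable_continuous_onI)
  have i\<zeta>: "integrable lebesgue (\<lambda>x. \<zeta> x * f x)" if "integrable lebesgue f" for f
    using integrable_cutoff_mult[OF _ \<zeta>(1,2) that] smooth[of 0] by simp
  have g: "norm (?g x) \<le> B" for x
    by (rule order_trans[OF B(2)]) (use B(1) in \<open>auto simp: indicator_def\<close>)
  have iA: "integrable lebesgue (\<lambda>x. \<bar>?w x\<bar> * norm (?G x))"
  proof (rule Bochner_Integration.integrable_bound[OF H(5)])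
    show "AE x in lebesgue. norm (\<bar>?w x\<bar> * norm (?G x)) \<le> norm (energy_density ?w x)"
    proof (intro AE_I2)
      fix x
      have "2 * (\<bar>?w x\<bar> * norm (?G x)) \<le> energy_density ?w x"
        using zero_le_power2[of "\<bar>?w x\<bar> - norm (?G x)"] by (simp add: power2_diff energy_density_def)
      moreover have "0 \<le> \<bar>?w x\<bar> * norm (?G x)" by simp
      ultimately show "norm (\<bar>?w x\<bar> * norm (?G x)) \<le> norm (energy_density ?w x)" by simp
    qed
  qed measurable
  show iA': "integrable lebesgue ?A"
    using integrable_mult_indicator[OF _ iA, of "cball (y i) R - ball (y i) r"] by simp
  have wg_le: "- (?w x * (?G x \<bullet> ?g x)) \<le> B * ?A x" and wg_abs: "\<bar>?w x * (?G x \<bullet> ?g x)\<bar> \<le> B * ?A x" for x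
  proof -
    have "\<bar>?w x * (?G x \<bullet> ?g x)\<bar> \<le> \<bar>?w x\<bar> * (norm (?G x) * norm (?g x))"
      unfolding abs_mult by (intro mult_left_mono Cauchy_Schwarz_ineq2) simp
    also have "\<dots> \<le> \<bar>?w x\<bar> * (norm (?G x) * (B * indicator (cball (y i) R - ball (y i) r) x))"
      by (intro mult_left_mono B(2)) auto
    finally show "\<bar>?w x * (?G x \<bullet> ?g x)\<bar> \<le> B * ?A x" by (simp add: mult_ac)
    then show "- (?w x * (?G x \<bullet> ?g x)) \<le> B * ?A x" by linarith
  qed
  have iwg: "integrable lebesgue (\<lambda>x. ?w x * (?G x \<bullet> ?g x))"
  proof (rule Bochner_Integration.integrable_bound[OF integrable_mult_right[OF iA', of B]])
    show "AE x in lebesgue. norm (?w x * (?G x \<bullet> ?g x)) \<le> norm (B * ?A x)"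
      unfolding real_norm_def by (intro AE_I2 order_trans[OF wg_abs abs_ge_self])
  qed measurable
  have i\<zeta>e: "integrable lebesgue (\<lambda>x. \<zeta> x * energy_density ?w x)"
    by (rule i\<zeta>[OF H(5)])
  have i\<zeta>P: "integrable lebesgue (\<lambda>x. \<zeta> x * (\<mu> i * \<bar>?w x\<bar> powr (2 * p)))"
    by (intro i\<zeta> integrable_mult_right integrable_powr i)
  have m: "(\<lambda>x. \<zeta> x * ?w x) \<in> H1"
    by (rule mult_in_H1[OF w smooth \<zeta>(1,2) g])
  have "(LINT x|lebesgue. \<zeta> x * energy_density ?w x) + (LINT x|lebesgue. ?w x * (?G x \<bullet> ?g x))
      = (LINT x|lebesgue. \<zeta> x * energy_density ?w x + ?w x * (?G x \<bullet> ?g x))"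
    by (rule Bochner_Integration.integral_add[OF i\<zeta>e iwg, symmetric])
  also have "\<dots> = (LINT x|lebesgue. ?G x \<bullet> weak_gradient (\<lambda>x. \<zeta> x * ?w x) x + ?w x * (\<zeta> x * ?w x))"
  proof (rule integral_cong_AE)
    show "AE x in lebesgue. \<zeta> x * energy_density ?w x + ?w x * (?G x \<bullet> ?g x)
        = ?G x \<bullet> weak_gradient (\<lambda>x. \<zeta> x * ?w x) x + ?w x * (\<zeta> x * ?w x)"
      using weak_gradient_mult[OF w smooth \<zeta>(1,2) g]
      by eventually_elim
        (simp add: energy_density_eq inner_add_right algebra_simps)
    show "(\<lambda>x. \<zeta> x * energy_density ?w x + ?w x * (?G x \<bullet> ?g x)) \<in> borel_measurable lebesgue"
      using i\<zeta>e iwg by (intro borel_measurable_add) auto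
    show "(\<lambda>x. ?G x \<bullet> weak_gradient (\<lambda>x. \<zeta> x * ?w x) x + ?w x * (\<zeta> x * ?w x)) \<in> borel_measurable lebesgue"
      by (intro borel_measurable_add borel_measurable_inner borel_measurable_times[OF H(1)] H(2) H1_integrable(1,2)[OF m])
  qed
  also have "\<dots> = (LINT x|lebesgue. nonlinearity l p y \<mu> \<Lambda> \<epsilon> v i x * (\<zeta> x * ?w x))"
    using sol i m by (auto simp: weak_solution_def)
  \<comment> \<open>Where \<zeta> is nonzero, x lies at distance more than r >= \<epsilon> from
    \<open>y i\<close>, so Q = -1 there; the coupling terms are nonpositive and are dropped.\<close>
  also have "\<dots> \<le> (LINT x|lebesgue. - (\<zeta> x * (\<mu> i * \<bar>?w x\<bar> powr (2 * p))))"
  proof (rule integral_mono)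
    show "integrable lebesgue (\<lambda>x. nonlinearity l p y \<mu> \<Lambda> \<epsilon> v i x * (\<zeta> x * ?w x))"
      using i\<zeta>[OF integrable_nonlinearity_mult_self] by (simp add: mult_ac)
    show "integrable lebesgue (\<lambda>x. - (\<zeta> x * (\<mu> i * \<bar>?w x\<bar> powr (2 * p))))"
      using i\<zeta>P by simp
    show "nonlinearity l p y \<mu> \<Lambda> \<epsilon> v i x * (\<zeta> x * ?w x) \<le> - (\<zeta> x * (\<mu> i * \<bar>?w x\<bar> powr (2 * p)))" for x
    proof (cases "norm (x - y i) \<le> r")
      case True
      then show ?thesis using \<zeta>(3) by simp
    next
      case False
      then have "x \<notin> ball (y i) \<epsilon>" using r by (simp add: dist_norm norm_minus_commute)
      then have "nonlinearity l p y \<mu> \<Lambda> \<epsilon> v i x * ?w x \<le> - (\<mu> i * \<bar>?w x\<bar> powr (2 * p))"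
        using nonlinearity_mult_self_le[of x] by simp
      from mult_left_mono[OF this \<zeta>(1)[of x]] show ?thesis by (simp add: mult_ac)
    qed
  qed
  finally have "(LINT x|lebesgue. \<zeta> x * energy_density ?w x) + (LINT x|lebesgue. ?w x * (?G x \<bullet> ?g x))
     \<le> - (LINT x|lebesgue. \<zeta> x * (\<mu> i * \<bar>?w x\<bar> powr (2 * p)))"
    by simp
  moreover have "(LINT x|lebesgue. \<zeta> x * (energy_density ?w x + \<mu> i * \<bar>?w x\<bar> powr (2 * p)))
      = (LINT x|lebesgue. \<zeta> x * energy_density ?w x) + (LINT x|lebesgue. \<zeta> x * (\<mu> i * \<bar>?w x\<bar> powr (2 * p)))"
    unfolding distrib_left by (rule Bochner_Integration.integral_add[OF i\<zeta>e i\<zeta>P])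
  moreover have "(LINT x|lebesgue. - (?w x * (?G x \<bullet> ?g x))) \<le> (LINT x|lebesgue. B * ?A x)"
    by (intro integral_mono wg_le) (use iwg iA' in auto)
  ultimately show "(LINT x|lebesgue. \<zeta> x * (energy_density ?w x + \<mu> i * \<bar>?w x\<bar> powr (2 * p))) \<le> B * (LINT x|lebesgue. ?A x)"
    by simp
qed

end

end

section \<open>Quantitative decay away from the centre\<close>

text \<open>Stands in for Hoelder's inequality on a bounded set: either t^2 is below the threshold
  \<tau>, or (t^2/\<tau>)^(p-1) >= 1 can be multiplied in. The threshold stays free and is adapted
  to the energy later.\<close>

lemma square_le_powr:
  fixes t \<tau> p :: real
  assumes "\<tau> > 0" "p > 1"
  shows "t\<^sup>2 \<le> \<tau> + \<tau> powr (1 - p) * \<bar>t\<bar> powr (2 * p)"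
proof (cases "t\<^sup>2 \<le> \<tau>")
  case True
  then show ?thesis by (simp add: add_increasing2)
next
  case False
  then have "t \<noteq> 0" using assms by auto
  have "\<bar>t\<bar> powr (2 * p) = (t\<^sup>2) powr p"
    using \<open>t \<noteq> 0\<close> by (simp add: powr_powr[symmetric])
  also have "\<dots> = t\<^sup>2 * (t\<^sup>2) powr (p - 1)"
    using \<open>t \<noteq> 0\<close> by (simp add: powr_diff)
  also have "\<dots> \<ge> t\<^sup>2 * \<tau> powr (p - 1)"
    using False assms by (intro mult_left_mono powr_mono2) auto
  finally have "\<tau> powr (1 - p) * (t\<^sup>2 * \<tau> powr (p - 1)) \<le> \<tau> powr (1 - p) * \<bar>t\<bar> powr (2 * p)"
    by (intro mult_left_mono) auto
  moreover have "\<tau> powr (1 - p) * (t\<^sup>2 * \<tau> powr (p - 1)) = t\<^sup>2"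
    using assms by (simp add: powr_diff field_simps)
  ultimately show ?thesis using assms by linarith
qed

lemma mult_le_weighted_squares:
  fixes a b c \<kappa> :: real
  assumes "\<kappa> > 0"
  shows "c * (a * b) \<le> \<kappa> * b\<^sup>2 + c\<^sup>2 / (4 * \<kappa>) * a\<^sup>2"
proof -
  have "0 \<le> (2 * \<kappa> * b - c * a)\<^sup>2 / (4 * \<kappa>)" using assms by simp
  also have "\<dots> = \<kappa> * b\<^sup>2 + c\<^sup>2 / (4 * \<kappa>) * a\<^sup>2 - c * (a * b)"
    using assms by (simp add: power2_eq_square field_simps)
  finally show ?thesis by simp
qed

context component
begin

text \<open>Two nested cutoffs. The one equal to 1 beyond radius r bounds |w|^(2p) on the annulus
  carrying the gradient of \<zeta> by a multiple of the energy. For \<zeta> itself, Young's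
  inequality with weight \<kappa> splits |w| |grad w|, and \<open>square_le_powr\<close> trades w^2
  on the annulus for its measure and that integral. In the result the first summand is small with
  \<kappa>, the second for fixed \<kappa> once the energy is large.\<close>

lemma exterior_bound:
  fixes r R s S B B' :: real and \<zeta> \<zeta>' :: "'a \<Rightarrow> real"
  assumes smooth: "\<And>k. Ck k \<zeta>" and \<zeta>: "\<And>x. 0 \<le> \<zeta> x" "\<And>x. \<zeta> x \<le> 1" "\<And>x. norm (x - y i) \<le> r \<Longrightarrow> \<zeta> x = 0"
    and B: "B > 0" "\<And>x. norm (gradient \<zeta> x) \<le> B * indicator (cball (y i) R - ball (y i) r) x"
    and smooth': "\<And>k. Ck k \<zeta>'" and \<zeta>': "\<And>x. 0 \<le> \<zeta>' x" "\<And>x. \<zeta>' x \<le> 1" "\<And>x. norm (x - y i) \<le> s \<Longrightarrow> \<zeta>' x = 0"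
      "\<And>x. norm (x - y i) \<ge> r \<Longrightarrow> \<zeta>' x = 1"
    and B': "B' > 0" "\<And>x. norm (gradient \<zeta>' x) \<le> B' * indicator (cball (y i) S - ball (y i) s) x"
    and s: "\<epsilon> \<le> s" "s \<le> r" and \<kappa>: "\<kappa> > 0"
  shows "(LINT x|lebesgue. \<zeta> x * (energy_density (v i) x + \<mu> i * \<bar>v i x\<bar> powr (2 * p)))
     \<le> energy * (\<kappa> * (1 + B\<^sup>2 / 4 * measure lebesgue (cball (y i) R - ball (y i) r))
        + B\<^sup>2 / (4 * \<kappa>) * (\<kappa>\<^sup>2) powr (1 - p) * (B' / \<mu> i) * energy powr (1 - p))"
proof -
  let ?A = "cball (y i) R - ball (y i) r" and ?A' = "cball (y i) S - ball (y i) s"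
  let ?P = "\<lambda>x. \<bar>v i x\<bar> powr (2 * p)" and ?G = "weak_gradient (v i)" and ?e = "energy_density (v i)"
  define m where "m = measure lebesgue ?A"
  define E where "E = energy"
  have E: "E > 0" using energy_pos by (simp add: E_def)
  have w: "v i \<in> H1" by (rule H1[OF i])
  note H = H1_integrable[OF w]
  have iP: "integrable lebesgue ?P" by (rule integrable_powr[OF i])
  have A: "?A \<in> sets lebesgue" "emeasure lebesgue ?A < \<infinity>" 
  proof -
    show "?A \<in> sets lebesgue" by auto
    have "emeasure lebesgue ?A \<le> emeasure lebesgue (cball (y i) R)" by (intro emeasure_mono) auto
    also have "\<dots> < \<infinity>" using emeasure_lborel_cball_finite[of "y i" R] by simp
    finally show "emeasure lebesgue ?A < \<infinity>" .
  qed
  note cut = cutoff_estimate[OF smooth \<zeta> B order_trans[OF s]]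
  note cut' = cutoff_estimate[OF smooth' \<zeta>'(1-3) B' s(1)]
  note i\<zeta>' = integrable_cutoff_mult[OF smooth'[of 0, unfolded Ck.simps] \<zeta>'(1,2)]
  \<comment> \<open>On \<open>?A\<close> the auxiliary cutoff \<zeta>' equals 1, so its estimate
    controls the power there; its own annulus term is bounded crudely by B' times the whole
    energy.\<close>
  have "\<mu> i * (LINT x|lebesgue. indicator ?A x * ?P x) = (LINT x|lebesgue. \<mu> i * (indicator ?A x *\<^sub>R ?P x))"
    by simp
  also have "\<dots> \<le> (LINT x|lebesgue. \<zeta>' x * (?e x + \<mu> i * ?P x))"
  proof (rule integral_mono)
    show "integrable lebesgue (\<lambda>x. \<mu> i * (indicator ?A x *\<^sub>R ?P x))"
      by (intro integrable_mult_right integrable_mult_indicator A iP)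
    show "integrable lebesgue (\<lambda>x. \<zeta>' x * (?e x + \<mu> i * ?P x))"
      by (intro i\<zeta>' Bochner_Integration.integrable_add H(5) integrable_mult_right iP)
    show "\<mu> i * (indicator ?A x *\<^sub>R ?P x) \<le> \<zeta>' x * (?e x + \<mu> i * ?P x)" for x
      using \<zeta>'(1)[of x] \<zeta>'(4)[of x] \<mu> energy_density_nonneg[of "v i" x]
      by (auto simp: indicator_def dist_norm norm_minus_commute)
  qed
  also have "\<dots> \<le> B' * (LINT x|lebesgue. indicator ?A' x * (\<bar>v i x\<bar> * norm (?G x)))"
    by (rule cut'(2))
  also have "\<dots> \<le> B' * E"
    unfolding E_def
  proof (intro mult_left_mono integral_mono cut'(1) H(5))
    show "indicator ?A' x * (\<bar>v i x\<bar> * norm (?G x)) \<le> ?e x" for x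
      using mult_le_sum_squares[of "\<bar>v i x\<bar>" "norm (?G x)"] energy_density_nonneg[of "v i" x]
      by (auto simp: indicator_def energy_density_def add.commute)
  qed (use B'(1) in auto)
  finally have P: "(LINT x|lebesgue. indicator ?A x * ?P x) \<le> B' / \<mu> i * E"
    using \<mu> by (simp add: field_simps)
  \<comment> \<open>Young's inequality leaves the factor 1/\<kappa> in front of w^2. The square of
    \<kappa> in \<tau> turns the measure term into order \<kappa> E, and the factor E turns
    \<tau>^(1-p) into a multiple of E^(1-p).\<close>
  define \<tau> where "\<tau> = \<kappa>\<^sup>2 * E"
  have \<tau>: "\<tau> > 0" using \<kappa> E by (simp add: \<tau>_def)
  have "(LINT x|lebesgue. \<zeta> x * (?e x + \<mu> i * ?P x)) \<le> B * (LINT x|lebesgue. indicator ?A x * (\<bar>v i x\<bar> * norm (?G x)))"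
    by (rule cut(2))
  also have "\<dots> = (LINT x|lebesgue. B * (indicator ?A x * (\<bar>v i x\<bar> * norm (?G x))))"
    by simp
  also have "\<dots> \<le> (LINT x|lebesgue. \<kappa> * ?e x + B\<^sup>2 / (4 * \<kappa>) * (\<tau> * indicator ?A x + \<tau> powr (1 - p) * (indicator ?A x *\<^sub>R ?P x)))"
  proof (rule integral_mono)
    show "integrable lebesgue (\<lambda>x. B * (indicator ?A x * (\<bar>v i x\<bar> * norm (?G x))))"
      by (rule integrable_mult_right[OF cut(1)])
    show "integrable lebesgue (\<lambda>x. \<kappa> * ?e x + B\<^sup>2 / (4 * \<kappa>) * (\<tau> * indicator ?A x + \<tau> powr (1 - p) * (indicator ?A x *\<^sub>R ?P x)))"
      using A by (intro Bochner_Integration.integrable_add integrable_mult_right H(5) integrable_mult_indicator iP integrable_real_indicator)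
    fix x
    have "B * (\<bar>v i x\<bar> * norm (?G x)) \<le> \<kappa> * (norm (?G x))\<^sup>2 + B\<^sup>2 / (4 * \<kappa>) * (v i x)\<^sup>2"
      using mult_le_weighted_squares[OF \<kappa>, of B "\<bar>v i x\<bar>" "norm (?G x)"] by simp
    also have "\<dots> \<le> \<kappa> * ?e x + B\<^sup>2 / (4 * \<kappa>) * (\<tau> + \<tau> powr (1 - p) * ?P x)"
      using \<kappa> \<tau> p by (intro add_mono mult_left_mono square_le_powr) (auto simp: energy_density_def)
    finally show "B * (indicator ?A x * (\<bar>v i x\<bar> * norm (?G x)))
        \<le> \<kappa> * ?e x + B\<^sup>2 / (4 * \<kappa>) * (\<tau> * indicator ?A x + \<tau> powr (1 - p) * (indicator ?A x *\<^sub>R ?P x))"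
      using \<kappa> energy_density_nonneg[of "v i" x] by (auto simp: indicator_def)
  qed
  also have "\<dots> = \<kappa> * E + B\<^sup>2 / (4 * \<kappa>) * (\<tau> * m + \<tau> powr (1 - p) * (LINT x|lebesgue. indicator ?A x * ?P x))"
  proof -
    have a: "integrable lebesgue (\<lambda>x. \<tau> * indicator ?A x :: real)"
      using A by (intro integrable_mult_right integrable_real_indicator)
    have b: "integrable lebesgue (\<lambda>x. \<tau> powr (1 - p) * (indicator ?A x *\<^sub>R ?P x))"
      by (intro integrable_mult_right integrable_mult_indicator iP A)
    have "(LINT x|lebesgue. \<kappa> * ?e x + B\<^sup>2 / (4 * \<kappa>) * (\<tau> * indicator ?A x + \<tau> powr (1 - p) * (indicator ?A x *\<^sub>R ?P x)))
       = (LINT x|lebesgue. \<kappa> * ?e x) + (LINT x|lebesgue. B\<^sup>2 / (4 * \<kappa>) * (\<tau> * indicator ?A x + \<tau> powr (1 - p) * (indicator ?A x *\<^sub>R ?P x)))"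
      by (intro Bochner_Integration.integral_add integrable_mult_right H(5) Bochner_Integration.integrable_add a b)
    also have "(LINT x|lebesgue. B\<^sup>2 / (4 * \<kappa>) * (\<tau> * indicator ?A x + \<tau> powr (1 - p) * (indicator ?A x *\<^sub>R ?P x)))
       = B\<^sup>2 / (4 * \<kappa>) * ((LINT x|lebesgue. \<tau> * indicator ?A x) + (LINT x|lebesgue. \<tau> powr (1 - p) * (indicator ?A x *\<^sub>R ?P x)))"
      using Bochner_Integration.integral_add[OF a b] by simp
    finally show ?thesis by (simp add: E_def m_def)
  qed
  also have "\<dots> \<le> \<kappa> * E + B\<^sup>2 / (4 * \<kappa>) * (\<tau> * m + \<tau> powr (1 - p) * (B' / \<mu> i * E))"
    using P \<kappa> by (intro add_mono mult_left_mono order_refl) auto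
  also have "\<tau> powr (1 - p) = (\<kappa>\<^sup>2) powr (1 - p) * E powr (1 - p)"
    unfolding \<tau>_def by (rule powr_mult)
  also have "\<kappa> * E + B\<^sup>2 / (4 * \<kappa>) * (\<tau> * m + (\<kappa>\<^sup>2) powr (1 - p) * E powr (1 - p) * (B' / \<mu> i * E))
      = E * (\<kappa> * (1 + B\<^sup>2 / 4 * m) + B\<^sup>2 / (4 * \<kappa>) * (\<kappa>\<^sup>2) powr (1 - p) * (B' / \<mu> i) * E powr (1 - p))"
    using \<kappa> by (simp add: \<tau>_def field_simps power2_eq_square)
  finally show ?thesis by (simp add: E_def m_def)
qed

end

section \<open>Passage to the limit\<close>

lemma set_integral_ge_integral_minus_cutoff:
  fixes f :: "'a::euclidean_space \<Rightarrow> real"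
  assumes f: "integrable lebesgue f" "\<And>x. 0 \<le> f x" and S: "S \<in> sets lebesgue"
    and \<zeta>: "integrable lebesgue (\<lambda>x. \<zeta> x * f x)" "\<And>x. 0 \<le> \<zeta> x" "\<And>x. x \<notin> S \<Longrightarrow> \<zeta> x = 1"
  shows "(LINT x|lebesgue. f x) - (LINT x|lebesgue. \<zeta> x * f x) \<le> (LINT x:S|lebesgue. f x)"
    and "(LINT x:S|lebesgue. f x) \<le> (LINT x|lebesgue. f x)"
proof -
  have i: "integrable lebesgue (\<lambda>x. indicator S x *\<^sub>R f x)"
    by (rule integrable_mult_indicator[OF S f(1)])
  have "(LINT x|lebesgue. f x) - (LINT x|lebesgue. \<zeta> x * f x) = (LINT x|lebesgue. f x - \<zeta> x * f x)"
    using f(1) \<zeta>(1) by simp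
  also have "\<dots> \<le> (LINT x|lebesgue. indicator S x *\<^sub>R f x)"
    using f \<zeta> i by (intro integral_mono) (auto simp: indicator_def)
  finally show "(LINT x|lebesgue. f x) - (LINT x|lebesgue. \<zeta> x * f x) \<le> (LINT x:S|lebesgue. f x)"
    by (simp add: set_lebesgue_integral_def)
  show "(LINT x:S|lebesgue. f x) \<le> (LINT x|lebesgue. f x)"
    unfolding set_lebesgue_integral_def using f i by (intro integral_mono) (auto simp: indicator_def)
qed

text \<open>Serves both limits: b is the whole integral, a its part in the ball, and c X bounds the
  rest, where X is the cut-off sum of energy and \<mu> times power. It is used with c = 1 for the
  energy and c = 1 / \<mu> for the power; the lower bound on b says that it is at least of order
  E.\<close>

lemma ratio_tendsto_1:
  fixes a b X E :: "nat \<Rightarrow> real"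
  assumes lim: "(\<lambda>n. X n / E n) \<longlonglongrightarrow> 0" and E: "\<And>n. E n > 0" and c: "c > 0"
    and a: "\<And>n. b n - c * X n \<le> a n" "\<And>n. a n \<le> b n" and b: "\<And>n. E n \<le> b n / c" and X: "\<And>n. X n \<ge> 0"
  shows "(\<lambda>n. a n / b n) \<longlonglongrightarrow> 1"
proof (rule tendsto_sandwich)
  have b0: "b n > 0" for n using E[of n] b[of n] c by (smt (verit) divide_nonpos_pos)
  show "\<forall>\<^sub>F n in sequentially. 1 - X n / E n \<le> a n / b n"
  proof (intro always_eventually allI)
    fix n
    have "c * X n / b n = X n / (b n / c)" using c by simp
    also have "\<dots> \<le> X n / E n"
      using b[of n] E[of n] X[of n] b0[of n] c by (intro divide_left_mono) auto
    finally have "1 - X n / E n \<le> (b n - c * X n) / b n"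
      using b0[of n] by (simp add: diff_divide_distrib)
    also have "\<dots> \<le> a n / b n"
      using a(1) b0[of n] by (intro divide_right_mono) auto
    finally show "1 - X n / E n \<le> a n / b n" .
  qed
  show "\<forall>\<^sub>F n in sequentially. a n / b n \<le> 1"
    using a(2) b0 by (intro always_eventually allI) (simp add: divide_le_eq_1)
  show "(\<lambda>n. 1 - X n / E n) \<longlonglongrightarrow> 1"
    using tendsto_diff[OF tendsto_const lim, of 1] by simp
qed simp

theorem theorem1p5:
  fixes l :: nat and p :: real
    and y :: "nat \<Rightarrow> 'a::euclidean_space"
    and \<mu> :: "nat \<Rightarrow> real" and \<Lambda> :: "nat \<Rightarrow> nat \<Rightarrow> real"
    and \<epsilon> :: "nat \<Rightarrow> real"
    and v :: "nat \<Rightarrow> nat \<Rightarrow> 'a \<Rightarrow> real"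
  assumes "DIM('a) \<ge> 3"
    and "l > 0"
    and "1 < p" and "p < real DIM('a) / (real DIM('a) - 2)"
    and "\<And>i. i \<in> {1..l} \<Longrightarrow> \<mu> i > 0"
    and "\<And>i j. i \<in> {1..l} \<Longrightarrow> j \<in> {1..l} \<Longrightarrow> i \<noteq> j \<Longrightarrow> \<Lambda> i j = \<Lambda> j i \<and> \<Lambda> i j < 0"
    and "\<And>n. \<epsilon> n > 0" and "\<epsilon> \<longlonglongrightarrow> 0"
    and "\<And>n. weak_solution l p y \<mu> \<Lambda> (\<epsilon> n) (v n)"
  shows "\<forall>\<delta>>0. \<forall>i\<in>{1..l}.
    (\<lambda>n. (LINT x:cball (y i) \<delta>|lebesgue. energy_density (v n i) x)
          / (LINT x|lebesgue. energy_density (v n i) x)) \<longlonglongrightarrow> 1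
    \<and> (\<lambda>n. (LINT x:cball (y i) \<delta>|lebesgue. \<bar>v n i x\<bar> powr (2 * p))
          / (LINT x|lebesgue. \<bar>v n i x\<bar> powr (2 * p))) \<longlonglongrightarrow> 1"
proof (intro allI impI ballI)
  fix \<delta> :: real and i assume \<delta>: "\<delta> > 0" and i: "i \<in> {1..l}"
  have comp: "component l p y \<mu> \<Lambda> (\<epsilon> n) (v n) i" for n
    using assms i by unfold_locales auto
  have \<mu>: "\<mu> i > 0" using assms i by simp
  define E where "E n = (LINT x|lebesgue. energy_density (v n i) x)" for n
  let ?P = "\<lambda>n x. \<bar>v n i x\<bar> powr (2 * p)"
  have E: "E n > 0" for n
    unfolding E_def by (rule component.energy_pos[OF comp])
  have p': "2 \<le> 2 * p" "2 * p < 2 * real DIM('a) / (real DIM('a) - 2)"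
    using assms(3,4) by auto

  have E_lim: "(\<lambda>n. E n powr (1 - p)) \<longlonglongrightarrow> 0"
  proof (rule tendstoI)
    fix e :: real assume e: "e > 0"
    \<comment> \<open>Chosen so that \<mu> \<eta> = e/2 in
      \<open>component.energy_powr_small\<close>.\<close>
    define \<eta> where "\<eta> = e / (2 * \<mu> i)"
    have "\<eta> > 0" using e \<mu> by (simp add: \<eta>_def)
    then obtain \<rho> where \<rho>: "\<rho> > 0" "\<And>(u :: 'a \<Rightarrow> real) z. u \<in> H1 \<Longrightarrow>
        (LINT x|lebesgue. indicator (ball z \<rho>) x * \<bar>u x\<bar> powr (2 * p)) \<le> \<eta> * (LINT x|lebesgue. energy_density u x) powr (2 * p / 2)"
      using H1_powr_ball_small[OF assms(1) p'] by blast
    have "\<forall>\<^sub>F n in sequentially. \<epsilon> n < \<rho>"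
      using order_tendstoD(2)[OF assms(8) \<rho>(1)] .
    then show "\<forall>\<^sub>F n in sequentially. dist (E n powr (1 - p)) 0 < e"
    proof eventually_elim
      case (elim n)
      have "E n powr (1 - p) \<le> \<mu> i * \<eta>"
        unfolding E_def
        by (rule component.energy_powr_small[OF comp less_imp_le[OF elim]])
          (use \<rho>(2)[OF component.H1[OF comp i], of "y i" n] in simp)
      also have "\<dots> < e" using e \<mu> by (simp add: \<eta>_def)
      finally show ?case by simp
    qed
  qed

  \<comment> \<open>The radii \<delta>/4, \<delta>/2, \<delta> nest the two cutoffs: \<zeta>' is
    already 1 on the annulus from \<delta>/2 to \<delta> where \<zeta> varies, and both vanish on
    the attractive ball once \<epsilon> is below \<delta>/4.\<close>
  obtain \<zeta> :: "'a \<Rightarrow> real" and B where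
    \<zeta>: "\<And>k. Ck k \<zeta>" "\<And>x. 0 \<le> \<zeta> x" "\<And>x. \<zeta> x \<le> 1" "\<And>x. norm (x - y i) \<le> \<delta> / 2 \<Longrightarrow> \<zeta> x = 0"
    and \<zeta>1: "\<And>x. norm (x - y i) \<ge> \<delta> \<Longrightarrow> \<zeta> x = 1"
    and B: "B > 0" "\<And>x. norm (gradient \<zeta> x) \<le> B * indicator (cball (y i) \<delta> - ball (y i) (\<delta> / 2)) x"
    using smooth_cutoff[of "\<delta> / 2" \<delta> "y i"] \<delta> by (metis field_sum_of_halves half_gt_zero less_add_same_cancel1)
  obtain \<zeta>' :: "'a \<Rightarrow> real" and B' where
    \<zeta>': "\<And>k. Ck k \<zeta>'" "\<And>x. 0 \<le> \<zeta>' x" "\<And>x. \<zeta>' x \<le> 1" "\<And>x. norm (x - y i) \<le> \<delta> / 4 \<Longrightarrow> \<zeta>' x = 0"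
      "\<And>x. norm (x - y i) \<ge> \<delta> / 2 \<Longrightarrow> \<zeta>' x = 1"
    and B': "B' > 0" "\<And>x. norm (gradient \<zeta>' x) \<le> B' * indicator (cball (y i) (\<delta> / 2) - ball (y i) (\<delta> / 4)) x"
    by (rule smooth_cutoff[of "\<delta> / 4" "\<delta> / 2" "y i"]) (use \<delta> in auto)
  define m where "m = measure lebesgue (cball (y i) \<delta> - ball (y i) (\<delta> / 2))"
  define X where "X n = (LINT x|lebesgue. \<zeta> x * (energy_density (v n i) x + \<mu> i * ?P n x))" for n
  have X0: "X n \<ge> 0" for n
    unfolding X_def using \<mu> by (intro Bochner_Integration.integral_nonneg mult_nonneg_nonneg add_nonneg_nonneg \<zeta>(2) energy_density_nonneg) auto

  have X_lim: "(\<lambda>n. X n / E n) \<longlonglongrightarrow> 0"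
  proof (rule tendstoI)
    fix e :: real assume e: "e > 0"
    define K where "K = 1 + B\<^sup>2 / 4 * m"
    have K: "K > 0" by (simp add: K_def m_def add_pos_nonneg)
    \<comment> \<open>This makes \<kappa> K = e/2. The constant D below depends on \<kappa> but not
      on n, so D E^(1-p) falls below e/2 eventually.\<close>
    define \<kappa> where "\<kappa> = e / (2 * K)"
    have \<kappa>: "\<kappa> > 0" using e K by (simp add: \<kappa>_def)
    define D where "D = B\<^sup>2 / (4 * \<kappa>) * (\<kappa>\<^sup>2) powr (1 - p) * (B' / \<mu> i)"
    have "(\<lambda>n. D * E n powr (1 - p)) \<longlonglongrightarrow> D * 0"
      by (intro tendsto_mult tendsto_const E_lim)
    then have "\<forall>\<^sub>F n in sequentially. D * E n powr (1 - p) < e / 2"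
      using e by (intro order_tendstoD(2)[of _ "D * 0"]) auto
    moreover have "\<forall>\<^sub>F n in sequentially. \<epsilon> n < \<delta> / 4"
      using order_tendstoD(2)[OF assms(8), of "\<delta> / 4"] \<delta> by simp
    ultimately show "\<forall>\<^sub>F n in sequentially. dist (X n / E n) 0 < e"
    proof eventually_elim
      case (elim n)
      have "X n \<le> E n * (\<kappa> * K + D * E n powr (1 - p))"
        unfolding X_def E_def K_def D_def m_def
        by (rule component.exterior_bound[OF comp \<zeta> B \<zeta>' B' _ _ \<kappa>]) (use elim \<delta> in auto)
      then have "X n / E n \<le> \<kappa> * K + D * E n powr (1 - p)"
        using E[of n] by (simp add: field_simps)
      also have "\<dots> < e / 2 + e / 2"
        using elim K by (simp add: \<kappa>_def)
      finally show ?case using X0[of n] E[of n] by simp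
    qed
  qed

  have iE: "integrable lebesgue (energy_density (v n i))" for n
    by (rule H1_integrable(5)[OF component.H1[OF comp i]])
  have iP: "integrable lebesgue (?P n)" for n
    by (rule component.integrable_powr[OF comp i])
  have i\<zeta>: "integrable lebesgue (\<lambda>x. \<zeta> x * f x)" if "integrable lebesgue f" for f
    using integrable_cutoff_mult[OF _ \<zeta>(2,3) that] \<zeta>(1)[of 0] by simp
  have X_eq: "X n = (LINT x|lebesgue. \<zeta> x * energy_density (v n i) x) + \<mu> i * (LINT x|lebesgue. \<zeta> x * ?P n x)" for n
  proof -
    have "X n = (LINT x|lebesgue. \<zeta> x * energy_density (v n i) x + \<mu> i * (\<zeta> x * ?P n x))"
      unfolding X_def by (simp add: algebra_simps)
    then show ?thesis using i\<zeta>[OF iE] i\<zeta>[OF iP] by simp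
  qed
  have nn: "0 \<le> (LINT x|lebesgue. \<zeta> x * energy_density (v n i) x)" "0 \<le> (LINT x|lebesgue. \<zeta> x * ?P n x)" for n
    by (intro Bochner_Integration.integral_nonneg mult_nonneg_nonneg \<zeta>(2) energy_density_nonneg powr_ge_zero)+
  have out: "\<zeta> x = 1" if "x \<notin> cball (y i) \<delta>" for x
    using that by (intro \<zeta>1) (simp add: dist_norm norm_minus_commute)
  have cb: "cball (y i) \<delta> \<in> sets lebesgue" by simp
  note cutE = set_integral_ge_integral_minus_cutoff[OF iE energy_density_nonneg cb i\<zeta>[OF iE] \<zeta>(2) out]
  note cutP = set_integral_ge_integral_minus_cutoff[OF iP powr_ge_zero cb i\<zeta>[OF iP] \<zeta>(2) out]
  show "(\<lambda>n. (LINT x:cball (y i) \<delta>|lebesgue. energy_density (v n i) x)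
          / (LINT x|lebesgue. energy_density (v n i) x)) \<longlonglongrightarrow> 1
    \<and> (\<lambda>n. (LINT x:cball (y i) \<delta>|lebesgue. ?P n x) / (LINT x|lebesgue. ?P n x)) \<longlonglongrightarrow> 1"
  proof (intro conjI)
    show "(\<lambda>n. (LINT x:cball (y i) \<delta>|lebesgue. energy_density (v n i) x)
          / (LINT x|lebesgue. energy_density (v n i) x)) \<longlonglongrightarrow> 1"
    proof (rule ratio_tendsto_1[OF X_lim E zero_less_one _ cutE(2) _ X0])
      fix n
      have "(LINT x|lebesgue. \<zeta> x * energy_density (v n i) x) \<le> X n"
        using nn[of n] \<mu> by (simp add: X_eq)
      then show "(LINT x|lebesgue. energy_density (v n i) x) - 1 * X n \<le> (LINT x:cball (y i) \<delta>|lebesgue. energy_density (v n i) x)"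
        using cutE(1)[of n] by simp
    qed (simp_all add: E_def)
    show "(\<lambda>n. (LINT x:cball (y i) \<delta>|lebesgue. ?P n x) / (LINT x|lebesgue. ?P n x)) \<longlonglongrightarrow> 1"
    proof (rule ratio_tendsto_1[OF X_lim E _ _ cutP(2) _ X0])
      show "1 / \<mu> i > 0" using \<mu> by simp
      fix n
      have "(LINT x|lebesgue. \<zeta> x * ?P n x) \<le> 1 / \<mu> i * X n"
        using nn[of n] \<mu> by (simp add: X_eq field_simps)
      then show "(LINT x|lebesgue. ?P n x) - 1 / \<mu> i * X n \<le> (LINT x:cball (y i) \<delta>|lebesgue. ?P n x)"
        using cutP(1)[of n] by simp
      show "E n \<le> (LINT x|lebesgue. ?P n x) / (1 / \<mu> i)"
        using component.energy_le_powr[OF comp, of n] by (simp add: E_def mult.commute)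
    qed
  qed
qed

end
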